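(* Let $k$ be a unitarily invariant CNP kernel on $\mathbb{B}_d$. Let $\mathbf T=(T_1,\dots,T_d)$ be a $1/k$-contraction on a Hilbert space $\mathcal H$ such that $\dim(\mathrm{Ran}\,\Delta_{\mathbf T})<\infty$. Let $\theta_{\mathbf T}:\mathbb{B}_d\to\mathcal B(\mathcal D_{\tilde{\mathbf T}},\overline{\mathrm{Ran}}\,\Delta_{\mathbf T})$ be the characteristic function of $\mathbf T$. Then the Taylor joint spectrum $\sigma(\mathbf T)$ satisfies $$\sigma(\mathbf T)\supset E_{\theta_{\mathbf T}}\cup F_{\theta_{\mathbf T}}.$$
   Context: $\mathbb{B}_d$ is the open Euclidean unit ball of $\mathbb{C}^d$ and $\overline{\mathbb{B}}_d$ its closure. A unitarily invariant CNP kernel on $\mathbb{B}_d$ (regularity is part of the definition) is a reproducing kernel $k(\bm z,\bm w)=\sum_{n=0}^\infty a_n\langle\bm z,\bm w\rangle^n$ on $\mathbb{B}_d$ with $a_0=1$, $a_n>0$ for all $n$, $\lim_{n\to\infty}a_n/a_{n+1}=1$, such that there are real numbers $b_n\ge 0$ ($n\ge1$) with $1-\frac{1}{k(\bm z,\bm w)}=\sum_{n=1}^\infty b_n\langle\bm z,\bm w\rangle^n$ for $\bm z,\bm w\in\mathbb{B}_d$ (equivalently $k$ is an irreducible complete Nevanlinna–Pick kernel). For $\alpha\in\mathbb{Z}_+^d\setminus\{0\}$ put $b_\alpha=b_{|\alpha|}\frac{|\alpha|!}{\alpha!}$. A commuting tuple $\mathbf T=(T_1,\dots,T_d)$ of bounded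 operators on a Hilbert space $\mathcal H$ is a $1/k$-contraction if $\sum_{\alpha\in\mathbb{Z}_+^d\setminus\{0\}}b_\alpha\mathbf T^\alpha(\mathbf T^\alpha)^*$ converges strongly to a contraction; then $\Delta_{\mathbf T}=\big(I-\sum_{\alpha\neq0}b_\alpha\mathbf T^\alpha(\mathbf T^\alpha)^*\big)^{1/2}$. Characteristic function: let $\tilde{\mathcal H}=\bigoplus_{\alpha\in\mathbb{Z}_+^d\setminus\{0\}}\mathcal H$. Let $\tilde{\mathbf T}:\tilde{\mathcal H}\to\mathcal H$, $(h_\alpha)\mapsto\sum_{\alpha\ne0}b_\alpha^{1/2}\mathbf T^\alpha h_\alpha$, and for $\bm z\in\mathbb{B}_d$ let $\mathbf Z:\tilde{\mathcal H}\to\mathcal H$, $(h_\alpha)\mapsto\sum_{\alpha\neq0}b_\alpha^{1/2}\bm z^\alpha h_\alpha$. Put $D_{\tilde{\mathbf T}}=(I-\tilde{\mathbf T}^*\tilde{\mathbf T})^{1/2}$ and $\mathcal D_{\tilde{\mathbf T}}=\overline{\mathrm{Ran}}\,D_{\tilde{\mathbf T}}$. Then $\theta_{\mathbf T}(\bm z)=\big(-\tilde{\mathbf T}+\Delta_{\mathbf T}(I_{\mathcal H}-\mathbf Z\tilde{\mathbf T}^* )^{-1}\mathbf Z D_{\tilde{\mathbf T}}\big)|_{\mathcal D_{\tilde{\mathbf T}}}$ for $\bm z\in\mathbb{B}_d$. For an operator-valued function $\theta$ on $\mathbb{B}_d$, $E_\theta$ is the set of $\bm\lambda\in\overline{\mathbb{B}}_d$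 such that $\lim_{\bm z\to\bm\lambda,\,\bm z\in\mathbb{B}_d}\theta(\bm z)$ exists (in operator norm) and is not surjective (onto $\overline{\mathrm{Ran}}\,\Delta_{\mathbf T}$ when $\theta=\theta_{\mathbf T}$), and $F_\theta$ is the set of $\bm\lambda\in\overline{\mathbb{B}}_d$ such that this limit does not exist. *)

theory Defs
  imports "HOL-Analysis.Analysis"
begin

section \<open>Complex Hilbert spaces\<close>

text \<open>HOL-Analysis only knows real inner products. A complex Hilbert space is rendered as a complete
  real inner product space with a compatible complex scalar multiplication and a complex inner
  product (linear in the first argument) whose real part is the given real inner product; norm and
  topology are therefore the usual ones.\<close>

class chilbert_space = real_inner + complete_space +
  fixes scaleC :: "complex \<Rightarrow> 'a \<Rightarrow> 'a" (infixr "*\<^sub>C" 75)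
    and cinner :: "'a \<Rightarrow> 'a \<Rightarrow> complex"
  assumes scaleC_add_right: "c *\<^sub>C (x + y) = c *\<^sub>C x + c *\<^sub>C y"
    and scaleC_add_left: "(c + c') *\<^sub>C x = c *\<^sub>C x + c' *\<^sub>C x"
    and scaleC_scaleC: "c *\<^sub>C c' *\<^sub>C x = (c * c') *\<^sub>C x"
    and scaleC_of_real: "complex_of_real r *\<^sub>C x = r *\<^sub>R x"
    and cinner_commute: "cinner x y = cnj (cinner y x)"
    and cinner_add_left: "cinner (x + y) z = cinner x z + cinner y z"
    and cinner_scaleC_left: "cinner (c *\<^sub>C x) y = c * cinner x y"
    and Re_cinner: "Re (cinner x y) = inner x y"

global_interpretation complex_vector:
  vector_space "scaleC :: complex \<Rightarrow> 'a \<Rightarrow> 'a :: chilbert_space"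
proof
  show "1 *\<^sub>C x = x" for x :: 'a
    using scaleC_of_real[of 1 x] by simp
qed (simp_all add: scaleC_add_right scaleC_add_left scaleC_scaleC)

lemma cinner_self: "cinner x x = complex_of_real ((norm x)\<^sup>2)"
  for x :: "'a :: chilbert_space"
proof -
  have "Im (cinner x x) = 0"
    using arg_cong[OF cinner_commute[of x x], of Im] by simp
  then show ?thesis
    by (simp add: complex_eq_iff Re_cinner power2_norm_eq_inner)
qed

lemma cinner_scaleC_right: "cinner x (c *\<^sub>C y) = cnj c * cinner x y"
  for x :: "'a :: chilbert_space"
  by (metis cinner_commute cinner_scaleC_left complex_cnj_cnj complex_cnj_mult)

lemma norm_scaleC: "norm (c *\<^sub>C x) = cmod c * norm x"
  for x :: "'a :: chilbert_space"
proof -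
  have "complex_of_real ((norm (c *\<^sub>C x))\<^sup>2) = c * cnj c * complex_of_real ((norm x)\<^sup>2)"
    by (metis cinner_self cinner_scaleC_left cinner_scaleC_right mult.assoc)
  also have "\<dots> = complex_of_real ((cmod c * norm x)\<^sup>2)"
    by (simp only: complex_norm_square[symmetric] power_mult_distrib of_real_mult of_real_power)
  finally have "(norm (c *\<^sub>C x))\<^sup>2 = (cmod c * norm x)\<^sup>2"
    using of_real_eq_iff by blast
  then show ?thesis
    by (simp add: power2_eq_iff_nonneg)
qed

lemma cmod_cinner_le: "cmod (cinner x y) \<le> norm x * norm y"
  for x :: "'a :: chilbert_space"
proof (cases "cinner x y = 0")
  case False
  define u where "u = cnj (sgn (cinner x y))"
  have u: "cmod u = 1" "u * cinner x y = complex_of_real (cmod (cinner x y))"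
    using False complex_norm_square[of "cinner x y"]
    by (auto simp: u_def sgn_eq norm_divide power2_eq_square field_simps)
  have "cmod (cinner x y) = inner (u *\<^sub>C x) y"
    by (metis Re_cinner Re_complex_of_real cinner_scaleC_left u(2))
  also have "\<dots> \<le> norm (u *\<^sub>C x) * norm y"
    by (rule norm_cauchy_schwarz)
  finally show ?thesis
    by (simp add: norm_scaleC u)
qed simp

section \<open>Hilbert space direct sums\<close>

typedef (overloaded) ('i, 'h :: real_normed_vector) hsum =
  "{f :: 'i \<Rightarrow> 'h. (\<lambda>i. (norm (f i))\<^sup>2) summable_on UNIV}"
  morphisms hsum_nth Abs_hsum
  by (rule exI[of _ "\<lambda>_. 0"]) simp

setup_lifting type_definition_hsum

lemma square_summable_add:
  fixes f g :: "'i \<Rightarrow> 'h :: real_normed_vector"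
  assumes "(\<lambda>i. (norm (f i))\<^sup>2) summable_on UNIV" "(\<lambda>i. (norm (g i))\<^sup>2) summable_on UNIV"
  shows "(\<lambda>i. (norm (f i + g i))\<^sup>2) summable_on UNIV"
proof (rule summable_on_comparison_test)
  show "(\<lambda>i. 2 * (norm (f i))\<^sup>2 + 2 * (norm (g i))\<^sup>2) summable_on UNIV"
    by (intro summable_on_add summable_on_cmult_right assms)
  show "(norm (f i + g i))\<^sup>2 \<le> 2 * (norm (f i))\<^sup>2 + 2 * (norm (g i))\<^sup>2" for i
  proof -
    have "(norm (f i + g i))\<^sup>2 \<le> (norm (f i) + norm (g i))\<^sup>2"
      by (intro power_mono norm_triangle_ineq) auto
    also have "\<dots> \<le> 2 * (norm (f i))\<^sup>2 + 2 * (norm (g i))\<^sup>2"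
      using zero_le_power2[of "norm (f i) - norm (g i)"]
      by (simp add: power2_eq_square algebra_simps)
    finally show ?thesis .
  qed
qed auto

lemma square_summable_scale:
  fixes f :: "'i \<Rightarrow> 'h :: real_normed_vector" and g :: "'i \<Rightarrow> 'g :: real_normed_vector"
  assumes "(\<lambda>i. (norm (f i))\<^sup>2) summable_on UNIV" "\<And>i. norm (g i) = c * norm (f i)"
  shows "(\<lambda>i. (norm (g i))\<^sup>2) summable_on UNIV"
  unfolding assms(2) power_mult_distrib by (intro summable_on_cmult_right assms)

lemma cinner_summable:
  fixes f g :: "'i \<Rightarrow> 'h :: chilbert_space"
  assumes "(\<lambda>i. (norm (f i))\<^sup>2) summable_on UNIV" "(\<lambda>i. (norm (g i))\<^sup>2) summable_on UNIV"
  shows "(\<lambda>i. cinner (f i) (g i)) summable_on UNIV"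
proof (rule abs_summable_summable, rule summable_on_comparison_test)
  show "(\<lambda>i. (norm (f i))\<^sup>2 + (norm (g i))\<^sup>2) summable_on UNIV"
    by (intro summable_on_add assms)
  show "norm (cinner (f i) (g i)) \<le> (norm (f i))\<^sup>2 + (norm (g i))\<^sup>2" for i
    using cmod_cinner_le[of "f i" "g i"] sum_squares_bound[of "norm (f i)" "norm (g i)"]
      mult_nonneg_nonneg[OF norm_ge_zero norm_ge_zero, of "f i" "g i"] by linarith
qed auto

instantiation hsum :: (type, real_normed_vector) real_vector
begin
lift_definition zero_hsum :: "('a, 'b) hsum" is "\<lambda>_. 0" by simp
lift_definition plus_hsum :: "('a, 'b) hsum \<Rightarrow> ('a, 'b) hsum \<Rightarrow> ('a, 'b) hsum"
  is "\<lambda>f g i. f i + g i" by (rule square_summable_add)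
lift_definition uminus_hsum :: "('a, 'b) hsum \<Rightarrow> ('a, 'b) hsum" is "\<lambda>f i. - f i" by simp
lift_definition minus_hsum :: "('a, 'b) hsum \<Rightarrow> ('a, 'b) hsum \<Rightarrow> ('a, 'b) hsum"
  is "\<lambda>f g i. f i - g i"
  using square_summable_add[of f "\<lambda>i. - g i" for f g] by simp
lift_definition scaleR_hsum :: "real \<Rightarrow> ('a, 'b) hsum \<Rightarrow> ('a, 'b) hsum"
  is "\<lambda>c f i. c *\<^sub>R f i" by (rule square_summable_scale) auto
instance
  by standard (transfer; simp add: fun_eq_iff algebra_simps)+
end

lemma cinner_hsum_summable:
  "(\<lambda>i. cinner (hsum_nth x i) (hsum_nth y i)) summable_on UNIV"
  for x y :: "('a, 'b :: chilbert_space) hsum"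
  using hsum_nth[of x] hsum_nth[of y] by (auto intro: cinner_summable)

lemma inner_hsum_summable:
  "(\<lambda>i. inner (hsum_nth x i) (hsum_nth y i)) summable_on UNIV"
  for x y :: "('a, 'b :: chilbert_space) hsum"
  using summable_on_Re[OF cinner_hsum_summable[of x y]] by (simp add: Re_cinner)

instantiation hsum :: (type, chilbert_space) real_inner
begin

lift_definition inner_hsum :: "('a, 'b) hsum \<Rightarrow> ('a, 'b) hsum \<Rightarrow> real"
  is "\<lambda>f g. \<Sum>\<^sub>\<infinity>i. inner (f i) (g i)" .
lift_definition norm_hsum :: "('a, 'b) hsum \<Rightarrow> real"
  is "\<lambda>f. sqrt (\<Sum>\<^sub>\<infinity>i. (norm (f i))\<^sup>2)" .
definition dist_hsum :: "('a, 'b) hsum \<Rightarrow> ('a, 'b) hsum \<Rightarrow> real"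
  where "dist_hsum x y = norm (x - y)"
definition sgn_hsum :: "('a, 'b) hsum \<Rightarrow> ('a, 'b) hsum"
  where "sgn_hsum x = x /\<^sub>R norm x"
definition uniformity_hsum :: "(('a, 'b) hsum \<times> ('a, 'b) hsum) filter"
  where "uniformity_hsum = (INF e\<in>{0<..}. principal {(x, y). dist x y < e})"
definition open_hsum :: "('a, 'b) hsum set \<Rightarrow> bool"
  where "open_hsum U \<longleftrightarrow> (\<forall>x\<in>U. \<forall>\<^sub>F (x', y) in uniformity. x' = x \<longrightarrow> y \<in> U)"

lemma norm_hsum_summable: "(\<lambda>i. (norm (hsum_nth x i))\<^sup>2) summable_on UNIV"
  for x :: "('a, 'b) hsum"
  using hsum_nth[of x] by simp

lemma norm_hsum_sq: "(norm x)\<^sup>2 = (\<Sum>\<^sub>\<infinity>i. (norm (hsum_nth x i))\<^sup>2)"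
  for x :: "('a, 'b) hsum"
  unfolding norm_hsum.rep_eq by (simp add: infsum_nonneg)

lemma norm_hsum_nonneg: "0 \<le> norm x"
  for x :: "('a, 'b) hsum"
  unfolding norm_hsum.rep_eq by (simp add: infsum_nonneg)

lemma sum_le_norm_hsum_sq: "finite F \<Longrightarrow> (\<Sum>i\<in>F. (norm (hsum_nth x i))\<^sup>2) \<le> (norm x)\<^sup>2"
  for x :: "('a, 'b) hsum"
  unfolding norm_hsum_sq by (rule finite_sum_le_infsum) (auto simp: norm_hsum_summable)

lemma norm_hsum_nth_le: "norm (hsum_nth x i) \<le> norm x"
  for x :: "('a, 'b) hsum"
  using sum_le_norm_hsum_sq[of "{i}" x] by (auto intro: power2_le_imp_le[OF _ norm_hsum_nonneg])

lemma norm_hsum_le: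
  fixes x :: "('a, 'b) hsum"
  assumes "0 \<le> e" "\<And>F. finite F \<Longrightarrow> (\<Sum>i\<in>F. (norm (hsum_nth x i))\<^sup>2) \<le> e\<^sup>2"
  shows "norm x \<le> e"
proof -
  have "(norm x)\<^sup>2 \<le> e\<^sup>2"
    unfolding norm_hsum_sq by (rule infsum_le_finite_sums[OF norm_hsum_summable assms(2)])
  then show ?thesis
    using assms(1) power2_le_imp_le by blast
qed

instance
proof
  fix x y z :: "('a, 'b) hsum" and r :: real and U :: "('a, 'b) hsum set"
  note nth_simps = plus_hsum.rep_eq scaleR_hsum.rep_eq zero_hsum.rep_eq
  show "dist x y = norm (x - y)" by (rule dist_hsum_def)
  show "sgn x = x /\<^sub>R norm x" by (rule sgn_hsum_def)
  show "uniformity = (INF e\<in>{0<..}. principal {(x :: ('a, 'b) hsum, y). dist x y < e})"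
    by (rule uniformity_hsum_def)
  show "open U \<longleftrightarrow> (\<forall>x\<in>U. \<forall>\<^sub>F (x', y) in uniformity. x' = x \<longrightarrow> y \<in> U)"
    by (rule open_hsum_def)
  show "inner x y = inner y x"
    unfolding inner_hsum.rep_eq by (simp add: inner_commute)
  show "inner (x + y) z = inner x z + inner y z"
    unfolding inner_hsum.rep_eq nth_simps inner_add_left
    by (rule infsum_add) (rule inner_hsum_summable)+
  show "inner (r *\<^sub>R x) y = r * inner x y"
    unfolding inner_hsum.rep_eq nth_simps inner_scaleR_left by (rule infsum_cmult_right')
  show "0 \<le> inner x x"
    unfolding inner_hsum.rep_eq by (simp add: infsum_nonneg)
  show "norm x = sqrt (inner x x)"
    unfolding inner_hsum.rep_eq norm_hsum.rep_eq by (simp add: power2_norm_eq_inner)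
  show "inner x x = 0 \<longleftrightarrow> x = 0"
  proof
    assume "inner x x = 0"
    then have "norm x = 0"
      unfolding inner_hsum.rep_eq norm_hsum.rep_eq by (simp add: power2_norm_eq_inner)
    then have "hsum_nth x i = 0" for i
      using norm_hsum_nth_le[of x i] by simp
    then show "x = 0"
      by (intro hsum_nth_inject[THEN iffD1] ext) (simp only: zero_hsum.rep_eq)
  qed (simp add: inner_hsum.rep_eq nth_simps)
qed
end

instantiation hsum :: (type, chilbert_space) chilbert_space
begin

lift_definition scaleC_hsum :: "complex \<Rightarrow> ('a, 'b) hsum \<Rightarrow> ('a, 'b) hsum"
  is "\<lambda>c f i. c *\<^sub>C f i" by (rule square_summable_scale) (auto simp: norm_scaleC)
lift_definition cinner_hsum :: "('a, 'b) hsum \<Rightarrow> ('a, 'b) hsum \<Rightarrow> complex"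
  is "\<lambda>f g. \<Sum>\<^sub>\<infinity>i. cinner (f i) (g i)" .

instance
proof
  fix X :: "nat \<Rightarrow> ('a, 'b) hsum"
  assume X: "Cauchy X"
  define f where "f i = lim (\<lambda>n. hsum_nth (X n) i)" for i
  have f: "(\<lambda>n. hsum_nth (X n) i) \<longlonglongrightarrow> f i" for i
  proof -
    have "Cauchy (\<lambda>n. hsum_nth (X n) i)"
    proof (rule CauchyI)
      fix e :: real assume "0 < e"
      then obtain M where M: "\<forall>m\<ge>M. \<forall>n\<ge>M. norm (X m - X n) < e"
        using X by (auto dest: CauchyD)
      have "norm (hsum_nth (X m) i - hsum_nth (X n) i) < e" if "M \<le> m" "M \<le> n" for m n
        using M that norm_hsum_nth_le[of "X m - X n" i]
        by (metis le_less_trans minus_hsum.rep_eq)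
      then show "\<exists>M. \<forall>m\<ge>M. \<forall>n\<ge>M. norm (hsum_nth (X m) i - hsum_nth (X n) i) < e"
        by blast
    qed
    then show ?thesis
      unfolding f_def by (simp add: Cauchy_convergent convergent_LIMSEQ_iff[symmetric])
  qed
  have tail: "\<exists>M. \<forall>m\<ge>M. \<forall>F. finite F \<longrightarrow>
      (\<Sum>i\<in>F. (norm (hsum_nth (X m) i - f i))\<^sup>2) \<le> e\<^sup>2" if e: "0 < e" for e
  proof -
    obtain M where M: "\<forall>m\<ge>M. \<forall>n\<ge>M. norm (X m - X n) < e"
      using X e by (auto dest: CauchyD)
    have "(\<Sum>i\<in>F. (norm (hsum_nth (X m) i - f i))\<^sup>2) \<le> e\<^sup>2" if "M \<le> m" "finite F" for m F
    proof (rule LIMSEQ_le_const2)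
      show "(\<lambda>n. \<Sum>i\<in>F. (norm (hsum_nth (X m) i - hsum_nth (X n) i))\<^sup>2)
          \<longlonglongrightarrow> (\<Sum>i\<in>F. (norm (hsum_nth (X m) i - f i))\<^sup>2)"
        by (intro tendsto_intros f)
      have "(\<Sum>i\<in>F. (norm (hsum_nth (X m) i - hsum_nth (X n) i))\<^sup>2) \<le> e\<^sup>2" if "M \<le> n" for n
      proof -
        have "(\<Sum>i\<in>F. (norm (hsum_nth (X m) i - hsum_nth (X n) i))\<^sup>2) \<le> (norm (X m - X n))\<^sup>2"
          using sum_le_norm_hsum_sq[OF \<open>finite F\<close>, of "X m - X n"] by (simp add: minus_hsum.rep_eq)
        also have "\<dots> \<le> e\<^sup>2"
          using M \<open>M \<le> m\<close> that by (intro power_mono) (auto intro: less_imp_le)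
        finally show ?thesis .
      qed
      then show "\<exists>N. \<forall>n\<ge>N. (\<Sum>i\<in>F. (norm (hsum_nth (X m) i - hsum_nth (X n) i))\<^sup>2) \<le> e\<^sup>2"
        by blast
    qed
    then show ?thesis by blast
  qed
  have "(\<lambda>i. (norm (f i))\<^sup>2) summable_on UNIV"
  proof -
    obtain M where M: "\<And>F. finite F \<Longrightarrow> (\<Sum>i\<in>F. (norm (hsum_nth (X M) i - f i))\<^sup>2) \<le> 1\<^sup>2"
      using tail[of 1] by auto
    have "(\<lambda>i. (norm (hsum_nth (X M) i - f i))\<^sup>2) summable_on UNIV"
      by (rule nonneg_bdd_above_summable_on) (use M in \<open>auto intro!: bdd_aboveI[of _ 1]\<close>)
    then have "(\<lambda>i. (norm (- (hsum_nth (X M) i - f i)))\<^sup>2) summable_on UNIV"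
      by (simp only: norm_minus_cancel)
    from square_summable_add[OF norm_hsum_summable[of "X M"] this] show ?thesis
      by simp
  qed
  then have nth: "hsum_nth (Abs_hsum f) = f"
    by (simp add: Abs_hsum_inverse)
  have "X \<longlonglongrightarrow> Abs_hsum f"
  proof (rule LIMSEQ_I)
    fix e :: real assume e: "0 < e"
    then obtain M where
      M: "\<forall>m\<ge>M. \<forall>F. finite F \<longrightarrow> (\<Sum>i\<in>F. (norm (hsum_nth (X m) i - f i))\<^sup>2) \<le> (e / 2)\<^sup>2"
      using tail[of "e / 2"] by auto
    have "norm (X m - Abs_hsum f) \<le> e / 2" if "M \<le> m" for m
      using M that e by (intro norm_hsum_le) (auto simp: minus_hsum.rep_eq nth)
    then show "\<exists>M. \<forall>m\<ge>M. norm (X m - Abs_hsum f) < e"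
      using e by (intro exI[of _ M]) fastforce
  qed
  then show "convergent X"
    by (rule convergentI)
next
  fix x y z :: "('a, 'b) hsum" and r :: real and c c' :: complex
  note nth_simps = plus_hsum.rep_eq scaleC_hsum.rep_eq
  show "c *\<^sub>C (x + y) = c *\<^sub>C x + c *\<^sub>C y"
    by transfer (simp add: scaleC_add_right)
  show "(c + c') *\<^sub>C x = c *\<^sub>C x + c' *\<^sub>C x"
    by transfer (simp add: scaleC_add_left)
  show "c *\<^sub>C c' *\<^sub>C x = (c * c') *\<^sub>C x"
    by transfer (simp add: scaleC_scaleC)
  show "complex_of_real r *\<^sub>C x = r *\<^sub>R x"
    by transfer (simp add: scaleC_of_real)
  show "cinner x y = cnj (cinner y x)"
    unfolding cinner_hsum.rep_eq infsum_cnj[symmetric] by (simp add: cinner_commute[symmetric])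
  show "cinner (x + y) z = cinner x z + cinner y z"
    unfolding cinner_hsum.rep_eq nth_simps cinner_add_left
    by (rule infsum_add) (rule cinner_hsum_summable)+
  show "cinner (c *\<^sub>C x) y = c * cinner x y"
    unfolding cinner_hsum.rep_eq nth_simps cinner_scaleC_left by (rule infsum_cmult_right')
  show "Re (cinner x y) = inner x y"
    unfolding cinner_hsum.rep_eq inner_hsum.rep_eq
    by (simp add: infsum_Re[OF cinner_hsum_summable, symmetric] Re_cinner)
qed
end

section \<open>Bounded operators\<close>

text \<open>Bounded operators are represented by the library's (real-)linear bounded maps, with complex
  linearity as an explicit predicate.\<close>

definition complex_linear :: "('a :: chilbert_space \<Rightarrow>\<^sub>L 'b :: chilbert_space) \<Rightarrow> bool"
  where "complex_linear A \<longleftrightarrow> (\<forall>c x. A (c *\<^sub>C x) = c *\<^sub>C A x)"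

definition adj :: "('a :: chilbert_space \<Rightarrow>\<^sub>L 'b :: chilbert_space) \<Rightarrow> ('b \<Rightarrow>\<^sub>L 'a)"
  where "adj A = (THE B :: 'b \<Rightarrow>\<^sub>L 'a. \<forall>x y. cinner (A x) y = cinner x (B y))"

definition positive_op :: "('a :: chilbert_space \<Rightarrow>\<^sub>L 'a) \<Rightarrow> bool"
  where "positive_op A \<longleftrightarrow>
    complex_linear A \<and> (\<forall>x. Im (cinner (A x) x) = 0 \<and> 0 \<le> Re (cinner (A x) x))"

definition op_sqrt :: "('a :: chilbert_space \<Rightarrow>\<^sub>L 'a) \<Rightarrow> 'a \<Rightarrow>\<^sub>L 'a"
  where "op_sqrt A = (THE S. positive_op S \<and> S o\<^sub>L S = A)"

definition op_inverse :: "('a :: real_normed_vector \<Rightarrow>\<^sub>L 'b :: real_normed_vector) \<Rightarrow> ('b \<Rightarrow>\<^sub>L 'a)"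
  where "op_inverse A = (THE B. A o\<^sub>L B = id_blinfun \<and> B o\<^sub>L A = id_blinfun)"

definition op_range :: "('a :: real_normed_vector \<Rightarrow>\<^sub>L 'b :: real_normed_vector) \<Rightarrow> 'b set"
  where "op_range A = range (blinfun_apply A)"

definition complex_finite_dim :: "'a :: chilbert_space set \<Rightarrow> bool"
  where "complex_finite_dim S \<longleftrightarrow> (\<exists>B. finite B \<and> S \<subseteq> complex_vector.span B)"

section \<open>Unitarily invariant CNP kernels\<close>

definition bracket :: "complex ^ 'd \<Rightarrow> complex ^ 'd \<Rightarrow> complex"
  where "bracket z w = (\<Sum>i\<in>UNIV. z $ i * cnj (w $ i))"

definition positive_kernel :: "'s set \<Rightarrow> ('s \<Rightarrow> 's \<Rightarrow> complex) \<Rightarrow> bool"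
  where "positive_kernel X k \<longleftrightarrow> (\<forall>F c. finite F \<longrightarrow> F \<subseteq> X \<longrightarrow>
    (let q = \<Sum>z\<in>F. \<Sum>w\<in>F. c z * cnj (c w) * k z w in Im q = 0 \<and> 0 \<le> Re q))"

text \<open>The coefficient sequences are arguments because the operators below are built from \<open>b\<close>; on
  the ball, \<open>k\<close> determines \<open>a\<close> and \<open>b\<close>, except for the value \<open>b 0\<close>, which is never used.\<close>

definition unitarily_invariant_CNP_kernel ::
  "(complex ^ 'd \<Rightarrow> complex ^ 'd \<Rightarrow> complex) \<Rightarrow> (nat \<Rightarrow> real) \<Rightarrow> (nat \<Rightarrow> real) \<Rightarrow> bool"
  where "unitarily_invariant_CNP_kernel k a b \<longleftrightarrow>
    positive_kernel (ball 0 1) k \<and>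
    (\<forall>z\<in>ball 0 1. \<forall>w\<in>ball 0 1. (\<lambda>n. complex_of_real (a n) * bracket z w ^ n) sums k z w) \<and>
    a 0 = 1 \<and> (\<forall>n. 0 < a n) \<and> (\<lambda>n. a n / a (Suc n)) \<longlonglongrightarrow> 1 \<and>
    (\<forall>n\<ge>1. 0 \<le> b n) \<and>
    (\<forall>z\<in>ball 0 1. \<forall>w\<in>ball 0 1. k z w \<noteq> 0 \<and>
      (\<lambda>n. complex_of_real (b (Suc n)) * bracket z w ^ Suc n) sums (1 - 1 / k z w))"

section \<open>Operator tuples and \<open>1/k\<close>-contractions\<close>

typedef 'd multiindex = "{\<alpha> :: 'd \<Rightarrow> nat. \<alpha> \<noteq> (\<lambda>_. 0)}"
  morphisms mi_nth Abs_multiindex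
  by (rule exI[of _ "\<lambda>_. 1"]) (simp add: fun_eq_iff)

definition mi_coeff :: "(nat \<Rightarrow> real) \<Rightarrow> 'd::finite multiindex \<Rightarrow> real"
  where "mi_coeff b \<alpha> =
    (let n = \<Sum>i\<in>UNIV. mi_nth \<alpha> i in b n * (fact n / (\<Prod>i\<in>UNIV. fact (mi_nth \<alpha> i))))"

definition vec_mpow :: "complex ^ 'd::finite \<Rightarrow> 'd multiindex \<Rightarrow> complex"
  where "vec_mpow z \<alpha> = (\<Prod>i\<in>UNIV. (z $ i) ^ mi_nth \<alpha> i)"

definition op_pow :: "('h \<Rightarrow>\<^sub>L 'h) \<Rightarrow> nat \<Rightarrow> 'h::real_normed_vector \<Rightarrow>\<^sub>L 'h"
  where "op_pow A n = (((o\<^sub>L) A) ^^ n) id_blinfun"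

text \<open>The factors are multiplied in increasing order of the index; for a commuting tuple the order
  is irrelevant.\<close>

definition op_mpow ::
  "('d::{finite,linorder} \<Rightarrow> 'h \<Rightarrow>\<^sub>L 'h) \<Rightarrow> 'd multiindex \<Rightarrow> 'h::real_normed_vector \<Rightarrow>\<^sub>L 'h"
  where "op_mpow T \<alpha> =
    foldr (\<lambda>i A. op_pow (T i) (mi_nth \<alpha> i) o\<^sub>L A) (sorted_list_of_set UNIV) id_blinfun"

definition commuting_tuple :: "('d \<Rightarrow> 'h \<Rightarrow>\<^sub>L 'h::chilbert_space) \<Rightarrow> bool"
  where "commuting_tuple T \<longleftrightarrow>
    (\<forall>i. complex_linear (T i)) \<and> (\<forall>i j. T i o\<^sub>L T j = T j o\<^sub>L T i)"

definition contraction_term ::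
  "(nat \<Rightarrow> real) \<Rightarrow> ('d::{finite,linorder} \<Rightarrow> 'h \<Rightarrow>\<^sub>L 'h) \<Rightarrow> 'd multiindex \<Rightarrow> 'h::chilbert_space \<Rightarrow>\<^sub>L 'h"
  where "contraction_term b T \<alpha> = mi_coeff b \<alpha> *\<^sub>R (op_mpow T \<alpha> o\<^sub>L adj (op_mpow T \<alpha>))"

definition one_over_k_contraction ::
  "(nat \<Rightarrow> real) \<Rightarrow> ('d::{finite,linorder} \<Rightarrow> 'h \<Rightarrow>\<^sub>L 'h::chilbert_space) \<Rightarrow> bool"
  where "one_over_k_contraction b T \<longleftrightarrow> commuting_tuple T \<and>
    (\<exists>S :: 'h \<Rightarrow>\<^sub>L 'h. norm S \<le> 1 \<and>
      (\<forall>h. ((\<lambda>\<alpha>. blinfun_apply (contraction_term b T \<alpha>) h) has_sum blinfun_apply S h) UNIV))"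

definition defect_op ::
  "(nat \<Rightarrow> real) \<Rightarrow> ('d::{finite,linorder} \<Rightarrow> 'h \<Rightarrow>\<^sub>L 'h) \<Rightarrow> 'h::chilbert_space \<Rightarrow>\<^sub>L 'h"
  where "defect_op b T =
    op_sqrt (id_blinfun - Blinfun (\<lambda>h. \<Sum>\<^sub>\<infinity>\<alpha>. contraction_term b T \<alpha> h))"

section \<open>The characteristic function\<close>

definition row_op ::
  "(nat \<Rightarrow> real) \<Rightarrow> ('d::{finite,linorder} \<Rightarrow> 'h \<Rightarrow>\<^sub>L 'h)
    \<Rightarrow> ('d multiindex, 'h) hsum \<Rightarrow>\<^sub>L 'h::chilbert_space"
  where "row_op b T = Blinfun (\<lambda>h. \<Sum>\<^sub>\<infinity>\<alpha>. sqrt (mi_coeff b \<alpha>) *\<^sub>R op_mpow T \<alpha> (hsum_nth h \<alpha>))"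

definition scalar_row_op ::
  "(nat \<Rightarrow> real) \<Rightarrow> complex ^ 'd::finite \<Rightarrow> ('d multiindex, 'h) hsum \<Rightarrow>\<^sub>L 'h::chilbert_space"
  where "scalar_row_op b z =
    Blinfun (\<lambda>h. \<Sum>\<^sub>\<infinity>\<alpha>. sqrt (mi_coeff b \<alpha>) *\<^sub>R (vec_mpow z \<alpha> *\<^sub>C hsum_nth h \<alpha>))"

definition row_defect_op ::
  "(nat \<Rightarrow> real) \<Rightarrow> ('d::{finite,linorder} \<Rightarrow> 'h \<Rightarrow>\<^sub>L 'h)
    \<Rightarrow> ('d multiindex, 'h) hsum \<Rightarrow>\<^sub>L ('d multiindex, 'h::chilbert_space) hsum"
  where "row_defect_op b T = op_sqrt (id_blinfun - (adj (row_op b T) o\<^sub>L row_op b T))"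

text \<open>The characteristic function takes values in operators from \<open>row_defect_space b T\<close> to
  \<open>defect_space b T\<close>. These subspaces are not types, so the formula is stated on the whole direct
  sum and every notion applied to it below is relative to the two subspaces.\<close>

definition row_defect_space ::
  "(nat \<Rightarrow> real) \<Rightarrow> ('d::{finite,linorder} \<Rightarrow> 'h \<Rightarrow>\<^sub>L 'h) \<Rightarrow> ('d multiindex, 'h::chilbert_space) hsum set"
  where "row_defect_space b T = closure (op_range (row_defect_op b T))"

definition defect_space ::
  "(nat \<Rightarrow> real) \<Rightarrow> ('d::{finite,linorder} \<Rightarrow> 'h \<Rightarrow>\<^sub>L 'h) \<Rightarrow> 'h::chilbert_space set"
  where "defect_space b T = closure (op_range (defect_op b T))"

definition char_fun ::
  "(nat \<Rightarrow> real) \<Rightarrow> ('d::{finite,linorder} \<Rightarrow> 'h \<Rightarrow>\<^sub>L 'h) \<Rightarrow> complex ^ 'd::{finite,linorder}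
    \<Rightarrow> ('d multiindex, 'h) hsum \<Rightarrow>\<^sub>L 'h::chilbert_space"
  where "char_fun b T z = - row_op b T +
    (defect_op b T o\<^sub>L op_inverse (id_blinfun - (scalar_row_op b z o\<^sub>L adj (row_op b T)))
      o\<^sub>L scalar_row_op b z o\<^sub>L row_defect_op b T)"

section \<open>Boundary behaviour of operator-valued functions\<close>

definition opnorm_on :: "'a set \<Rightarrow> ('a::real_normed_vector \<Rightarrow>\<^sub>L 'b::real_normed_vector) \<Rightarrow> real"
  where "opnorm_on D A = Sup {norm (A x) | x. x \<in> D \<and> norm x \<le> 1}"

text \<open>Here \<open>D\<close> and \<open>R\<close> are closed subspaces and \<open>L\<close> stands for its restriction in \<open>B(D, R)\<close>, which is
  the norm limit of \<open>\<theta> z\<close> as \<open>z\<close> tends to \<open>lam\<close> inside the ball. Every operator on \<open>D\<close>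
  has such an extension \<open>L\<close> to the whole space (compose with the orthogonal projection).\<close>

definition op_limit ::
  "'a::chilbert_space set \<Rightarrow> 'b::chilbert_space set \<Rightarrow> (complex ^ 'd \<Rightarrow> 'a \<Rightarrow>\<^sub>L 'b)
    \<Rightarrow> complex ^ 'd \<Rightarrow> ('a \<Rightarrow>\<^sub>L 'b) \<Rightarrow> bool"
  where "op_limit D R \<theta> lam L \<longleftrightarrow> complex_linear L \<and> L ` D \<subseteq> R \<and>
    ((\<lambda>z. opnorm_on D (\<theta> z - L)) \<longlongrightarrow> 0) (at lam within ball 0 1)"

definition E_set ::
  "'a::chilbert_space set \<Rightarrow> 'b::chilbert_space set \<Rightarrow> (complex ^ 'd \<Rightarrow> 'a \<Rightarrow>\<^sub>L 'b) \<Rightarrow> (complex ^ 'd) set"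
  where "E_set D R \<theta> = {lam \<in> cball 0 1. \<exists>L. op_limit D R \<theta> lam L \<and> L ` D \<noteq> R}"

definition F_set ::
  "'a::chilbert_space set \<Rightarrow> 'b::chilbert_space set \<Rightarrow> (complex ^ 'd \<Rightarrow> 'a \<Rightarrow>\<^sub>L 'b) \<Rightarrow> (complex ^ 'd) set"
  where "F_set D R \<theta> = {lam \<in> cball 0 1. \<nexists>L. op_limit D R \<theta> lam L}"

section \<open>Taylor joint spectrum\<close>

text \<open>The Koszul complex of \<open>A = (A\<^sub>1, \<dots>, A\<^sub>d)\<close> lives on the exterior algebra over \<open>\<complex>\<^sup>d\<close> tensored with
  the Hilbert space. An element is given by its coefficients with respect to the basis
  \<open>e\<^sub>S = e\<^bsub>i\<^sub>1\<^esub> \<and> \<dots> \<and> e\<^bsub>i\<^sub>p\<^esub>\<close>, where \<open>S = {i\<^sub>1 < \<dots> < i\<^sub>p}\<close>, and the differential sends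
  \<open>e\<^sub>S \<otimes> h\<close> to \<open>\<Sum>i. (e\<^sub>i \<and> e\<^sub>S) \<otimes> A\<^sub>i h\<close>. This map raises the degree \<open>p = card S\<close> by one, so
  exactness of the complex in every degree amounts to kernel = range on the whole
  exterior algebra.\<close>

definition koszul_map ::
  "('d::{finite,linorder} \<Rightarrow> 'h \<Rightarrow> 'h) \<Rightarrow> ('d set \<Rightarrow> 'h) \<Rightarrow> 'd set \<Rightarrow> 'h::real_vector"
  where "koszul_map A x S = (\<Sum>i\<in>S. (-1) ^ card {j \<in> S. j < i} *\<^sub>R A i (x (S - {i})))"

definition taylor_nonsingular :: "('d::{finite,linorder} \<Rightarrow> 'h \<Rightarrow> 'h::real_vector) \<Rightarrow> bool"
  where "taylor_nonsingular A \<longleftrightarrow> {x. koszul_map A x = (\<lambda>_. 0)} = range (koszul_map A)"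

definition taylor_spectrum ::
  "('d::{finite,linorder} \<Rightarrow> 'h \<Rightarrow>\<^sub>L 'h::chilbert_space) \<Rightarrow> (complex ^ 'd::{finite,linorder}) set"
  where "taylor_spectrum T = {lam. \<not> taylor_nonsingular (\<lambda>i h. T i h - (lam $ i) *\<^sub>C h)}"

end

theory Submission
  imports Defs
begin

text \<open>
  Let \<open>R\<close> be the row operator of \<open>T\<close>, let \<open>Z z\<close> be the scalar row operator, and let \<open>\<Delta>\<close> and \<open>D\<close> be the
  two defect operators; \<open>R\<close> and \<open>Z z\<close> are contractions for \<open>z\<close> in the closed ball. Suppose \<open>lam\<close> is
  not in the Taylor spectrum. Of this only exactness in the top degree of the Koszul complex is used:
  every vector is a sum of vectors \<open>(T i - lam i) x\<^sub>i\<close>. By uniform boundedness the sum of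
  \<open>\<parallel>(T i - lam i)\<^sup>* x\<parallel>\<^sup>2\<close> is at least \<open>c \<parallel>x\<parallel>\<^sup>2\<close> for some \<open>c > 0\<close>. For \<open>z\<close> near \<open>lam\<close>, comparing only the
  components of degree one gives
  \<open>2 Re \<langle>(I - Z z R\<^sup>*) x, x\<rangle> \<ge> \<parallel>R\<^sup>* x - (Z z)\<^sup>* x\<parallel>\<^sup>2 \<ge> b\<^sub>1 c / 4 \<parallel>x\<parallel>\<^sup>2\<close>,
  so \<open>I - Z z R\<^sup>*\<close> is invertible with inverse bounded uniformly up to \<open>lam\<close>, even if \<open>\<parallel>lam\<parallel> = 1\<close>.
  As \<open>Z z\<close> tends to \<open>Z lam\<close> in norm, the characteristic function converges at \<open>lam\<close>, to its defining
  formula there. Since \<open>R D = \<Delta> R\<close>, that limit satisfies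
  \<open>\<theta> lam D = \<Delta> (I - Z lam R\<^sup>*)\<^sup>-\<^sup>1 (Z lam - R)\<close>, and \<open>Z lam - R\<close> is surjective because its degree-one
  components are. Hence the range of the limit contains that of \<open>\<Delta>\<close>, which is closed when it is
  finite-dimensional.
\<close>

section \<open>Operators on complex Hilbert spaces\<close>

instance chilbert_space \<subseteq> banach ..

section \<open>Complex inner products and their real parts\<close>

lemma cinner_add_right: "cinner x (y + z) = cinner x y + cinner x z"
  for x :: "'a :: chilbert_space"
  by (metis cinner_add_left cinner_commute complex_cnj_add)

lemma cinner_zero_left [simp]: "cinner 0 x = 0"
  for x :: "'a :: chilbert_space"
  using cinner_add_left[of 0 0 x] by simp

lemma cinner_diff_left: "cinner (x - y) z = cinner x z - cinner y z"
  for x :: "'a :: chilbert_space"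
  using cinner_add_left[of "x - y" y z] by simp

lemma cinner_diff_right: "cinner x (y - z) = cinner x y - cinner x z"
  for x :: "'a :: chilbert_space"
  using cinner_add_right[of x "y - z" z] by simp

lemma cinner_eqI:
  assumes "\<And>x. cinner x y = cinner x z"
  shows "y = (z :: 'a :: chilbert_space)"
proof -
  have "cinner (y - z) (y - z) = 0"
    using assms by (simp add: cinner_diff_right)
  then show ?thesis
    by (simp add: cinner_self)
qed

lemma inner_eqI:
  assumes "\<And>x. inner x y = inner x z"
  shows "y = (z :: 'a :: real_inner)"
  using assms[of "y - z"] by (metis inner_diff_right inner_eq_zero_iff right_minus_eq)

text \<open>Both components are real inner products, so an identity proved for \<open>inner\<close>
  lifts to \<open>cinner\<close> as soon as the maps involved commute with multiplication by
  \<open>\<i>\<close>.\<close>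

lemma cinner_eq_inner: "cinner x y = Complex (inner x y) (- inner (\<i> *\<^sub>C x) y)"
  for x :: "'a :: chilbert_space"
proof -
  have "Re (cinner (\<i> *\<^sub>C x) y) = - Im (cinner x y)"
    by (simp add: cinner_scaleC_left)
  then show ?thesis
    by (simp add: complex_eq_iff Re_cinner)
qed

lemma inner_scaleC_left: "inner (c *\<^sub>C x) y = inner x (cnj c *\<^sub>C y)"
  for x :: "'a :: chilbert_space"
  by (simp add: Re_cinner[symmetric] cinner_scaleC_left cinner_scaleC_right)

lemma scaleC_diff_right: "c *\<^sub>C (x - y) = c *\<^sub>C x - c *\<^sub>C y"
  for x :: "'a :: chilbert_space"
  by (rule complex_vector.scale_right_diff_distrib)

lemma scaleC_scaleR: "c *\<^sub>C r *\<^sub>R x = r *\<^sub>R c *\<^sub>C x"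
  for x :: "'a :: chilbert_space"
  by (metis mult.commute scaleC_of_real scaleC_scaleC)

lemma bounded_linear_scaleC: "bounded_linear ((*\<^sub>C) c :: 'a \<Rightarrow> 'a :: chilbert_space)"
  by (rule bounded_linear_intro[of _ "cmod c"])
    (auto simp: scaleC_add_right scaleC_scaleR norm_scaleC mult.commute)

text \<open>Direct method: a minimising sequence of the quadratic functional below is Cauchy by the
  parallelogram law, and the first variation at its limit yields the representation.\<close>

theorem riesz_real:
  fixes f :: "'a :: {real_inner, complete_space} \<Rightarrow> real"
  assumes "bounded_linear f"
  shows "\<exists>u. \<forall>x. f x = inner x u"
proof -
  interpret f: bounded_linear f by fact
  \<comment> \<open>the representing vector minimises \<open>\<phi>\<close>\<close>
  define \<phi> where "\<phi> x = (norm x)\<^sup>2 - 2 * f x" for x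
  define m where "m = (INF x. \<phi> x)"
  obtain K where K: "\<And>x. norm (f x) \<le> norm x * K"
    using f.bounded by blast
  have "- K\<^sup>2 \<le> \<phi> x" for x
  proof -
    have "2 * f x \<le> 2 * (norm x * K)"
      using K[of x] by (auto simp: abs_le_iff)
    moreover have "0 \<le> (norm x - K)\<^sup>2" by simp
    ultimately show ?thesis
      unfolding \<phi>_def by (simp add: power2_eq_square algebra_simps)
  qed
  then have bdd: "bdd_below (range \<phi>)"
    by (auto intro!: bdd_belowI2)
  have m_le: "m \<le> \<phi> x" for x
    unfolding m_def by (rule cINF_lower[OF bdd]) simp
  have "\<exists>x. \<phi> x < m + inverse (real (Suc n))" for n
    unfolding m_def using cINF_less_iff[OF _ bdd, of "(INF x. \<phi> x) + inverse (real (Suc n))"]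
    by (auto simp: add_strict_increasing)
  then obtain X where X: "\<And>n. \<phi> (X n) < m + inverse (real (Suc n))"
    by metis
  \<comment> \<open>Parallelogram law at the midpoint of \<open>x\<close> and \<open>y\<close>. The
    terms with \<open>f\<close> cancel by linearity, so two near-minimisers are close to each
    other.\<close>
  have par: "(norm (x - y))\<^sup>2 \<le> 2 * (\<phi> x - m) + 2 * (\<phi> y - m)" for x y
  proof -
    have "(norm (x - y))\<^sup>2 = 2 * \<phi> x + 2 * \<phi> y - 4 * \<phi> ((1/2) *\<^sub>R (x + y))"
      unfolding \<phi>_def f.scaleR f.add
      by (simp add: power2_norm_eq_inner algebra_simps inner_commute)
    then show ?thesis
      using m_le[of "(1/2) *\<^sub>R (x + y)"] by simp
  qed
  have "Cauchy X"
  proof (rule CauchyI)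
    fix e :: real assume e: "0 < e"
    then have "0 < e\<^sup>2 / 4" by simp
    then obtain N where N: "inverse (real (Suc N)) < e\<^sup>2 / 4"
      using reals_Archimedean by blast
    have "norm (X p - X q) < e" if "N \<le> p" "N \<le> q" for p q
    proof -
      have "inverse (real (Suc p)) \<le> inverse (real (Suc N))"
        "inverse (real (Suc q)) \<le> inverse (real (Suc N))"
        using that by (auto intro: le_imp_inverse_le)
      then have "\<phi> (X p) < m + e\<^sup>2 / 4" "\<phi> (X q) < m + e\<^sup>2 / 4"
        using X[of p] X[of q] N by (smt (verit))+
      then have "(norm (X p - X q))\<^sup>2 < e\<^sup>2"
        using par[of "X p" "X q"] by argo
      then show ?thesis
        using e power2_less_imp_less by (metis less_imp_le)
    qed
    then show "\<exists>M. \<forall>p\<ge>M. \<forall>q\<ge>M. norm (X p - X q) < e" by blast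
  qed
  then obtain u where u: "X \<longlonglongrightarrow> u"
    using Cauchy_convergent convergent_def by blast
  have "(\<lambda>n. \<phi> (X n)) \<longlonglongrightarrow> \<phi> u"
    unfolding \<phi>_def by (intro tendsto_intros f.tendsto u)
  moreover have "(\<lambda>n. m + inverse (real (Suc n))) \<longlonglongrightarrow> m"
    using tendsto_add[OF tendsto_const LIMSEQ_inverse_real_of_nat] by simp
  ultimately have \<phi>u: "\<phi> u \<le> m"
    by (rule LIMSEQ_le) (use X less_imp_le in blast)
  have "f x = inner x u" for x
  proof -
    define d where "d = inner x u - f x"
    have pos: "0 \<le> 2 * t * d + t\<^sup>2 * (norm x)\<^sup>2" for t
    proof -
      have "\<phi> (u + t *\<^sub>R x) = \<phi> u + 2 * t * d + t\<^sup>2 * (norm x)\<^sup>2"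
        unfolding \<phi>_def f.scaleR f.add d_def power2_norm_eq_inner
        by (simp add: inner_commute algebra_simps power2_eq_square)
      then show ?thesis
        using m_le[of "u + t *\<^sub>R x"] \<phi>u by linarith
    qed
    \<comment> \<open>The quadratic in \<open>t\<close> is tested at \<open>- d / M\<close>, close
      to its minimiser; the summand 1 keeps \<open>M\<close> positive when
      \<open>x = 0\<close>.\<close>
    define M where "M = (norm x)\<^sup>2 + 1"
    have M: "0 < M" "(norm x)\<^sup>2 \<le> M"
      by (auto simp: M_def add_nonneg_pos)
    have "0 \<le> 2 * (- d / M) * d + (- d / M)\<^sup>2 * (norm x)\<^sup>2"
      by (rule pos)
    also have "\<dots> \<le> 2 * (- d / M) * d + (- d / M)\<^sup>2 * M"
      using M by (intro add_left_mono mult_left_mono) auto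
    also have "\<dots> = - (d\<^sup>2 / M)"
      using M by (simp add: power2_eq_square field_simps)
    finally have "d\<^sup>2 / M \<le> 0" by simp
    then have "d = 0"
      using M by (simp add: divide_le_0_iff)
    then show ?thesis
      by (simp add: d_def)
  qed
  then show ?thesis by blast
qed

section \<open>Existence and algebra of adjoints\<close>

lemma adj_unique:
  fixes A :: "'a :: chilbert_space \<Rightarrow>\<^sub>L 'b :: chilbert_space"
  assumes "\<And>x y. cinner (A x) y = cinner x (blinfun_apply B y)"
  shows "adj A = B"
  unfolding adj_def
proof (rule the_equality)
  fix C assume "\<forall>x y. cinner (A x) y = cinner x (blinfun_apply C y)"
  then show "C = B"
    using assms by (intro blinfun_eqI cinner_eqI) metis
qed (use assms in blast)

text \<open>Riesz provides the adjoint for the real inner product. Complex linearity of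
  \<open>A\<close> then transfers the identity to the imaginary part through
  \<open>cinner_eq_inner\<close>.\<close>

lemma adj_exists:
  fixes A :: "'a :: chilbert_space \<Rightarrow>\<^sub>L 'b :: chilbert_space"
  assumes "complex_linear A"
  shows "\<exists>B :: 'b \<Rightarrow>\<^sub>L 'a. \<forall>x y. cinner (A x) y = cinner x (B y)"
proof -
  have "\<exists>u. \<forall>x. inner (A x) y = inner x u" for y
    by (rule riesz_real) (intro bounded_linear_intros)
  then obtain B where B: "\<And>x y. inner (A x) y = inner x (B y)"
    by metis
  have "bounded_linear B"
  proof (rule bounded_linear_intro)
    show "B (y + z) = B y + B z" for y z
      by (rule inner_eqI) (simp add: B[symmetric] inner_add_right)
    show "B (r *\<^sub>R y) = r *\<^sub>R B y" for r y
      by (rule inner_eqI) (simp add: B[symmetric])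
    show "norm (B y) \<le> norm y * norm A" for y
    proof -
      have "(norm (B y))\<^sup>2 = inner (A (B y)) y"
        by (simp add: B power2_norm_eq_inner)
      also have "\<dots> \<le> norm A * norm (B y) * norm y"
        by (meson norm_cauchy_schwarz norm_blinfun mult_right_mono norm_ge_zero order_trans)
      finally show ?thesis
        by (cases "norm (B y) = 0") (auto simp: power2_eq_square algebra_simps)
    qed
  qed
  then have ap: "blinfun_apply (Blinfun B) = B"
    by (rule bounded_linear_Blinfun_apply)
  have "cinner (A x) y = cinner x (B y)" for x y
    using assms by (simp add: cinner_eq_inner B[symmetric] complex_linear_def)
  then show ?thesis
    by (intro exI[of _ "Blinfun B"]) (simp add: ap)
qed

lemma cinner_adj_right:
  fixes A :: "'a :: chilbert_space \<Rightarrow>\<^sub>L 'b :: chilbert_space"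
  assumes "complex_linear A"
  shows "cinner x (adj A y) = cinner (A x) y"
  using adj_exists[OF assms] adj_unique[of A] by metis

lemma cinner_adj_left:
  fixes A :: "'a :: chilbert_space \<Rightarrow>\<^sub>L 'b :: chilbert_space"
  assumes "complex_linear A"
  shows "cinner (adj A y) x = cinner y (A x)"
  by (metis assms cinner_adj_right cinner_commute)

lemma inner_adj_right:
  fixes A :: "'a :: chilbert_space \<Rightarrow>\<^sub>L 'b :: chilbert_space"
  assumes "complex_linear A"
  shows "inner x (adj A y) = inner (A x) y"
  by (metis assms cinner_adj_right Re_cinner)

lemma inner_adj_left:
  fixes A :: "'a :: chilbert_space \<Rightarrow>\<^sub>L 'b :: chilbert_space"
  assumes "complex_linear A"
  shows "inner (adj A y) x = inner y (A x)"
  by (metis assms inner_adj_right inner_commute)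

lemma complex_linear_adj:
  fixes A :: "'a :: chilbert_space \<Rightarrow>\<^sub>L 'b :: chilbert_space"
  assumes "complex_linear A"
  shows "complex_linear (adj A)"
  unfolding complex_linear_def
  by (intro allI cinner_eqI) (simp add: cinner_adj_right assms cinner_scaleC_right)

lemma norm_adj_apply_sq:
  fixes A :: "'a :: chilbert_space \<Rightarrow>\<^sub>L 'b :: chilbert_space"
  assumes "complex_linear A"
  shows "(norm (adj A y))\<^sup>2 = inner (A (adj A y)) y"
  by (simp add: power2_norm_eq_inner inner_adj_right assms)

lemma norm_adj_le:
  fixes A :: "'a :: chilbert_space \<Rightarrow>\<^sub>L 'b :: chilbert_space"
  assumes "complex_linear A"
  shows "norm (adj A) \<le> norm A"
proof (rule norm_blinfun_bound)
  fix y
  have "(norm (adj A y))\<^sup>2 \<le> norm A * norm (adj A y) * norm y"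
    unfolding norm_adj_apply_sq[OF assms]
    by (meson norm_cauchy_schwarz norm_blinfun mult_right_mono norm_ge_zero order_trans)
  then show "norm (adj A y) \<le> norm A * norm y"
    by (cases "norm (adj A y) = 0") (auto simp: power2_eq_square algebra_simps)
qed simp

lemma complex_linearD: "complex_linear A \<Longrightarrow> A (c *\<^sub>C x) = c *\<^sub>C A x"
  by (simp add: complex_linear_def)

lemma complex_linear_id: "complex_linear id_blinfun"
  by (simp add: complex_linear_def)

lemma complex_linear_compose: "complex_linear A \<Longrightarrow> complex_linear B \<Longrightarrow> complex_linear (A o\<^sub>L B)"
  by (simp add: complex_linear_def)

lemma complex_linear_add: "complex_linear A \<Longrightarrow> complex_linear B \<Longrightarrow> complex_linear (A + B)"
  by (simp add: complex_linear_def blinfun.add_left scaleC_add_right)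

lemma complex_linear_diff: "complex_linear A \<Longrightarrow> complex_linear B \<Longrightarrow> complex_linear (A - B)"
  by (simp add: complex_linear_def blinfun.diff_left scaleC_diff_right)

lemma complex_linear_minus: "complex_linear A \<Longrightarrow> complex_linear (- A)"
  by (simp add: complex_linear_def blinfun.minus_left)

lemma complex_linear_scaleR: "complex_linear A \<Longrightarrow> complex_linear (r *\<^sub>R A)"
  by (simp add: complex_linear_def blinfun.scaleR_left scaleC_scaleR)

lemma adj_scaleR:
  fixes A :: "'a :: chilbert_space \<Rightarrow>\<^sub>L 'b :: chilbert_space"
  assumes "complex_linear A"
  shows "adj (r *\<^sub>R A) = r *\<^sub>R adj A"
  by (rule adj_unique)
    (simp add: blinfun.scaleR_left scaleC_of_real[symmetric] cinner_scaleC_left cinner_scaleC_right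
      cinner_adj_right assms)

text \<open>Coercivity bounds \<open>A\<close> from below, which gives injectivity and the norm of
  the inverse. Surjectivity comes from Banach's fixed point theorem, so \<open>A\<close> may be
  non-symmetric, as the pencil will be.\<close>

theorem lax_milgram:
  fixes A :: "'a :: {real_inner, complete_space} \<Rightarrow>\<^sub>L 'a"
  assumes \<delta>: "0 < \<delta>" and coercive: "\<And>x. \<delta> * (norm x)\<^sup>2 \<le> inner (A x) x"
  shows "\<exists>B. A o\<^sub>L B = id_blinfun \<and> B o\<^sub>L A = id_blinfun \<and> norm B \<le> 1 / \<delta>"
proof -
  have below: "\<delta> * norm x \<le> norm (A x)" for x
  proof -
    have "\<delta> * (norm x)\<^sup>2 \<le> norm (A x) * norm x"
      using coercive[of x] norm_cauchy_schwarz order_trans by blast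
    then show ?thesis
      by (cases "norm x = 0") (auto simp: power2_eq_square algebra_simps)
  qed
  \<comment> \<open>for this \<open>t\<close>, the map \<open>x \<mapsto> x - t (A x - y)\<close> is a contraction\<close>
  define M where "M = max (norm A) \<delta>"
  have M: "norm A \<le> M" "\<delta> \<le> M" "0 < M"
    using \<delta> by (auto simp: M_def)
  define t where "t = \<delta> / M\<^sup>2"
  \<comment> \<open>\<open>c\<^sup>2\<close> is the minimum over all \<open>t\<close> of
    \<open>1 - 2 t \<delta> + t\<^sup>2 M\<^sup>2\<close>, attained at the \<open>t\<close> just
    chosen; \<delta> being at most \<open>M\<close> keeps the radicand nonnegative.\<close>
  define c where "c = sqrt (1 - (\<delta> / M)\<^sup>2)"
  have "0 < \<delta> / M" "\<delta> / M \<le> 1"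
    using M \<delta> by auto
  then have c2: "0 < (\<delta> / M)\<^sup>2" "(\<delta> / M)\<^sup>2 \<le> 1"
    using power_le_one[of "\<delta> / M" 2] by auto
  then have c: "0 \<le> c" "c < 1" "c\<^sup>2 = 1 - (\<delta> / M)\<^sup>2"
    by (auto simp: c_def)
  have contr: "norm (x - t *\<^sub>R A x) \<le> c * norm x" for x
  proof -
    have "(norm (x - t *\<^sub>R A x))\<^sup>2 = (norm x)\<^sup>2 - 2 * t * inner (A x) x + t\<^sup>2 * (norm (A x))\<^sup>2"
      unfolding power2_norm_eq_inner by (simp add: inner_commute algebra_simps power2_eq_square)
    also have "\<dots> \<le> (norm x)\<^sup>2 - 2 * t * (\<delta> * (norm x)\<^sup>2) + t\<^sup>2 * (M * norm x)\<^sup>2"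
    proof -
      have "2 * t * (\<delta> * (norm x)\<^sup>2) \<le> 2 * t * inner (A x) x"
        using coercive \<delta> M by (intro mult_left_mono) (auto simp: t_def)
      moreover have "norm (A x) \<le> M * norm x"
        using norm_blinfun[of A x] M by (meson mult_right_mono norm_ge_zero order_trans)
      then have "t\<^sup>2 * (norm (A x))\<^sup>2 \<le> t\<^sup>2 * (M * norm x)\<^sup>2"
        by (intro mult_left_mono power_mono) auto
      ultimately show ?thesis by linarith
    qed
    also have "\<dots> = (c * norm x)\<^sup>2"
    proof -
      have "t * \<delta> = (\<delta> / M)\<^sup>2" "(t * M)\<^sup>2 = (\<delta> / M)\<^sup>2"
        using M by (simp_all add: t_def power2_eq_square)
      then have "(norm x)\<^sup>2 - 2 * (t * \<delta>) * (norm x)\<^sup>2 + (t * M)\<^sup>2 * (norm x)\<^sup>2 = c\<^sup>2 * (norm x)\<^sup>2"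
        by (simp only: c(3)) (simp add: algebra_simps)
      then show ?thesis
        by (simp add: power_mult_distrib mult.assoc)
    qed
    finally show ?thesis
      by (rule power2_le_imp_le) (simp add: c)
  qed
  have surj: "\<exists>x. A x = y" for y
  proof -
    have "\<exists>!x. x - t *\<^sub>R (A x - y) = x"
    proof (rule banach_fix_type[OF c(1,2)], intro allI)
      fix x x'
      have eq: "x - t *\<^sub>R (A x - y) - (x' - t *\<^sub>R (A x' - y)) = (x - x') - t *\<^sub>R A (x - x')"
        by (simp add: blinfun.diff_right algebra_simps)
      then show "dist (x - t *\<^sub>R (A x - y)) (x' - t *\<^sub>R (A x' - y)) \<le> c * dist x x'"
        using contr[of "x - x'"] by (simp only: dist_norm eq)
    qed
    then obtain x where "x - t *\<^sub>R (A x - y) = x" by blast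
    then show ?thesis
      using \<delta> M by (auto simp: t_def)
  qed
  then obtain B where B: "\<And>y. A (B y) = y" by metis
  have inj: "x = x'" if "A x = A x'" for x x'
    using below[of "x - x'"] that \<delta> by (simp add: blinfun.diff_right mult_le_0_iff)
  have "bounded_linear B"
  proof (rule bounded_linear_intro)
    show "B (y + z) = B y + B z" for y z
      by (rule inj) (simp add: B blinfun.add_right)
    show "B (r *\<^sub>R y) = r *\<^sub>R B y" for r y
      by (rule inj) (simp add: B blinfun.scaleR_right)
    show "norm (B y) \<le> norm y * (1 / \<delta>)" for y
      using below[of "B y"] \<delta> by (simp add: B field_simps)
  qed
  then have ap: "blinfun_apply (Blinfun B) = B"
    by (rule bounded_linear_Blinfun_apply)
  show ?thesis
  proof (intro exI conjI)
    show "A o\<^sub>L Blinfun B = id_blinfun"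
      by (rule blinfun_eqI) (simp add: ap B)
    show "Blinfun B o\<^sub>L A = id_blinfun"
      by (rule blinfun_eqI, rule inj) (simp add: ap B)
    show "norm (Blinfun B) \<le> 1 / \<delta>"
      using below[of "B y" for y] \<delta> by (intro norm_blinfun_bound) (auto simp: ap B field_simps)
  qed
qed

section \<open>Square roots of positive operators\<close>

text \<open>Moving \<open>\<i>\<close> across the symmetric real form shows that
  \<open>inner (\<i> *\<^sub>C A x) x\<close> equals its own negative, so the quadratic form has no
  imaginary part.\<close>

lemma positive_opI:
  assumes "complex_linear A" and sym: "\<And>x y. inner (A x) y = inner x (A y)"
    and pos: "\<And>x. 0 \<le> inner (A x) x"
  shows "positive_op A"
  unfolding positive_op_def
proof (intro conjI allI)
  fix x
  have "inner (A (\<i> *\<^sub>C x)) x = inner (\<i> *\<^sub>C x) (A x)"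
    by (rule sym)
  then have "inner (\<i> *\<^sub>C A x) x = inner x (- \<i> *\<^sub>C A x)"
    by (simp add: complex_linearD[OF assms(1)] inner_scaleC_left)
  then have "inner (\<i> *\<^sub>C A x) x = 0"
    by (simp add: inner_commute complex_vector.scale_minus_left)
  then show "Im (cinner (A x) x) = 0"
    by (simp add: cinner_eq_inner)
  show "0 \<le> Re (cinner (A x) x)"
    by (simp add: Re_cinner pos)
qed (fact assms(1))

lemma positive_op_complex_linear: "positive_op A \<Longrightarrow> complex_linear A"
  by (simp add: positive_op_def)

lemma positive_op_nonneg: "positive_op A \<Longrightarrow> 0 \<le> inner (A x) x"
  by (simp add: positive_op_def Re_cinner)

text \<open>Polarisation: the quadratic form is real at \<open>x\<close>, \<open>y\<close> and
  \<open>x + \<i> *\<^sub>C y\<close>, and expanding the last value leaves exactly the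
  symmetry.\<close>

lemma positive_op_symmetric:
  assumes "positive_op A"
  shows "inner (A x) y = inner x (A y)"
proof -
  have cl: "A (\<i> *\<^sub>C y) = \<i> *\<^sub>C A y"
    using assms by (simp add: positive_op_def complex_linear_def)
  have "Im (cinner (A (x + \<i> *\<^sub>C y)) (x + \<i> *\<^sub>C y)) = 0" "Im (cinner (A x) x) = 0" "Im (cinner (A y) y) = 0"
    using assms by (auto simp: positive_op_def)
  then have "Re (cinner (A x) y) = Re (cinner (A y) x)"
    by (simp add: blinfun.add_right cl cinner_add_left cinner_add_right cinner_scaleC_left
        cinner_scaleC_right)
  then show ?thesis
    by (simp add: Re_cinner inner_commute)
qed

text \<open>If \<open>A x\<close> were nonzero, moving from \<open>x\<close> a little in the
  direction \<open>- A x\<close> would make the form negative, since its slope there is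
  \<open>- 2 p\<close>.\<close>

lemma positive_op_apply_eq_0:
  assumes "positive_op A" "inner (A x) x = 0"
  shows "A x = 0"
proof (rule ccontr)
  assume nz: "A x \<noteq> 0"
  define q where "q = inner (A (A x)) (A x)"
  define p where "p = inner (A x) (A x)"
  have p: "0 < p" and q: "0 \<le> q"
    using nz positive_op_nonneg[OF assms(1)] by (auto simp: p_def q_def)
  \<comment> \<open>Any \<open>t > 0\<close> with \<open>t * q < 2 * p\<close> would do; the summand
    1 covers the case \<open>q = 0\<close>.\<close>
  define t where "t = p / (q + 1)"
  have "0 \<le> inner (A (x - t *\<^sub>R A x)) (x - t *\<^sub>R A x)"
    by (rule positive_op_nonneg[OF assms(1)])
  also have "\<dots> = t * (t * q - 2 * p)"
    using assms(2) positive_op_symmetric[OF assms(1), of "A x" x]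
    by (simp add: blinfun.diff_right blinfun.scaleR_right inner_diff_left inner_diff_right
        p_def q_def inner_commute algebra_simps)
  also have "\<dots> < 0"
  proof -
    have "t * q \<le> p"
      using p q by (simp add: t_def field_simps)
    then show ?thesis
      using p q by (intro mult_pos_neg) (auto simp: t_def)
  qed
  finally show False by simp
qed

text \<open>By commutation \<open>S + R\<close> kills \<open>y = S x - R x\<close>. Both forms are
  nonnegative, so each vanishes at \<open>y\<close>; hence \<open>S y = R y = 0\<close>, and
  symmetry gives \<open>inner y y = 0\<close>.\<close>

lemma positive_square_root_unique:
  assumes S: "positive_op S" and R: "positive_op R" and eq: "S o\<^sub>L S = R o\<^sub>L R"
    and comm: "S o\<^sub>L R = R o\<^sub>L S"
  shows "S = R"
proof (rule blinfun_eqI)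
  fix x
  define y where "y = S x - R x"
  have SS: "S (S u) = R (R u)" and SR: "S (R u) = R (S u)" for u
    using eq comm by (metis blinfun_apply_blinfun_compose)+
  have "inner (S y) y + inner (R y) y = 0"
    by (simp add: y_def blinfun.diff_right SS SR inner_add_left[symmetric])
  then have "inner (S y) y = 0" "inner (R y) y = 0"
    using positive_op_nonneg[OF S, of y] positive_op_nonneg[OF R, of y] by linarith+
  then have "S y = 0" "R y = 0"
    using positive_op_apply_eq_0 S R by blast+
  moreover have "inner y y = inner x (S y) - inner x (R y)"
    using positive_op_symmetric[OF S, of x y] positive_op_symmetric[OF R, of x y]
    by (simp only: y_def inner_diff_left)
  ultimately show "S x = R x"
    by (simp add: y_def)
qed

text \<open>The iteration \<open>Y \<mapsto> (B + Y\<^sup>2) / 2\<close> converges to \<open>1 - \<surd>(1 - B)\<close>. It is dominated by the same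
  iteration for the number \<open>1\<close>, which increases to \<open>1\<close>; no functional calculus is needed.\<close>

primrec sqrt_iter :: "('a :: real_normed_vector \<Rightarrow>\<^sub>L 'a) \<Rightarrow> nat \<Rightarrow> 'a \<Rightarrow>\<^sub>L 'a" where
  "sqrt_iter B 0 = 0"
| "sqrt_iter B (Suc n) = (1/2) *\<^sub>R (B + (sqrt_iter B n o\<^sub>L sqrt_iter B n))"

primrec sqrt_bound :: "nat \<Rightarrow> real" where
  "sqrt_bound 0 = 0"
| "sqrt_bound (Suc n) = (1 + (sqrt_bound n)\<^sup>2) / 2"

definition sqrt_one_minus :: "('a :: real_normed_vector \<Rightarrow>\<^sub>L 'a) \<Rightarrow> 'a \<Rightarrow>\<^sub>L 'a" where
  "sqrt_one_minus B = id_blinfun - lim (sqrt_iter B)"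

lemma sqrt_bound_bounds: "0 \<le> sqrt_bound n" "sqrt_bound n \<le> 1"
proof (induction n)
  case (Suc n)
  { case 1 show ?case by simp }
  { case 2 show ?case using Suc power_le_one[of "sqrt_bound n" 2] by simp }
qed auto

lemma sqrt_bound_mono: "sqrt_bound n \<le> sqrt_bound (Suc n)"
  using zero_le_power2[of "1 - sqrt_bound n"] by (simp add: power2_eq_square algebra_simps)

lemma sqrt_bound_convergent: "convergent sqrt_bound"
proof (rule Bseq_mono_convergent)
  show "Bseq sqrt_bound"
    using sqrt_bound_bounds by (intro BseqI'[of _ 1]) auto
  show "\<forall>m. \<forall>n\<ge>m. sqrt_bound m \<le> sqrt_bound n"
    using incseq_SucI[of sqrt_bound, OF sqrt_bound_mono] by (auto simp: incseq_def)
qed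

context
  fixes B :: "'a :: banach \<Rightarrow>\<^sub>L 'a"
  assumes B: "norm B \<le> 1"
begin

lemma norm_sqrt_iter: "norm (sqrt_iter B n) \<le> sqrt_bound n"
proof (induction n)
  case (Suc n)
  have "norm (sqrt_iter B n o\<^sub>L sqrt_iter B n) \<le> (sqrt_bound n)\<^sup>2"
    using norm_blinfun_compose[of "sqrt_iter B n" "sqrt_iter B n"] Suc
    by (simp add: power2_eq_square) (meson Suc mult_mono norm_ge_zero order_trans)
  then have "norm (B + (sqrt_iter B n o\<^sub>L sqrt_iter B n)) \<le> 1 + (sqrt_bound n)\<^sup>2"
    using B norm_triangle_ineq[of B "sqrt_iter B n o\<^sub>L sqrt_iter B n"] by linarith
  then show ?case by simp
qed simp

text \<open>The difference of squares is split as \<open>U (U - V) + (U - V) V\<close>, which holds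
  without commutation. The same identity for the numbers \<open>u\<close> and \<open>v\<close>
  reproduces the scalar increment.\<close>

lemma norm_sqrt_iter_diff:
  "norm (sqrt_iter B (Suc n) - sqrt_iter B n) \<le> sqrt_bound (Suc n) - sqrt_bound n"
proof (induction n)
  case 0
  then show ?case using B by simp
next
  case (Suc n)
  define U V where "U = sqrt_iter B (Suc n)" and "V = sqrt_iter B n"
  define u v where "u = sqrt_bound (Suc n)" and "v = sqrt_bound n"
  have UV: "norm U \<le> u" "norm V \<le> v" "norm (U - V) \<le> u - v"
    using norm_sqrt_iter[of "Suc n"] norm_sqrt_iter[of n] Suc by (auto simp only: U_def V_def u_def v_def)
  have uv: "0 \<le> u" "0 \<le> v"
    using sqrt_bound_bounds by (auto simp only: u_def v_def)
  have "sqrt_iter B (Suc (Suc n)) - sqrt_iter B (Suc n)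
      = (1/2) *\<^sub>R ((U o\<^sub>L (U - V)) + ((U - V) o\<^sub>L V))"
  proof -
    have "sqrt_iter B (Suc (Suc n)) - sqrt_iter B (Suc n) = (1/2) *\<^sub>R (U o\<^sub>L U) - (1/2) *\<^sub>R (V o\<^sub>L V)"
      using sqrt_iter.simps(2)[of B "Suc n"] sqrt_iter.simps(2)[of B n]
      by (simp only: U_def V_def scaleR_add_right) simp
    then show ?thesis
      by (simp add: bounded_bilinear.diff_left[OF bounded_bilinear_blinfun_compose]
          bounded_bilinear.diff_right[OF bounded_bilinear_blinfun_compose] scaleR_diff_right)
  qed
  moreover have "norm (U o\<^sub>L (U - V)) \<le> u * (u - v)" "norm ((U - V) o\<^sub>L V) \<le> (u - v) * v"
    using UV uv norm_blinfun_compose[of U "U - V"] norm_blinfun_compose[of "U - V" V]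
    by (meson mult_mono norm_ge_zero order_trans)+
  ultimately have "norm (sqrt_iter B (Suc (Suc n)) - sqrt_iter B (Suc n))
      \<le> (1/2) * (u * (u - v) + (u - v) * v)"
    using norm_triangle_ineq[of "U o\<^sub>L (U - V)" "(U - V) o\<^sub>L V"] by simp
  also have "\<dots> = (1 + u\<^sup>2) / 2 - (1 + v\<^sup>2) / 2"
    by (simp add: power2_eq_square field_simps)
  also have "\<dots> = sqrt_bound (Suc (Suc n)) - sqrt_bound (Suc n)"
    by (simp only: u_def v_def sqrt_bound.simps(2))
  finally show ?case .
qed

text \<open>The increments are dominated by those of the convergent sequence
  \<open>sqrt_bound\<close>, hence absolutely summable, and their partial sums telescope from
  0.\<close>

lemma sqrt_iter_tendsto: "sqrt_iter B \<longlonglongrightarrow> id_blinfun - sqrt_one_minus B"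
proof -
  have "summable (\<lambda>n. sqrt_bound (Suc n) - sqrt_bound n)"
    using sqrt_bound_convergent by (metis convergent_def summable_def telescope_sums)
  then have "summable (\<lambda>n. sqrt_iter B (Suc n) - sqrt_iter B n)"
    by (rule summable_comparison_test'[of _ 0]) (rule norm_sqrt_iter_diff)
  then have "convergent (\<lambda>n. \<Sum>i<n. sqrt_iter B (Suc i) - sqrt_iter B i)"
    by (simp add: summable_iff_convergent)
  then have "convergent (sqrt_iter B)"
    by (simp only: sum_lessThan_telescope sqrt_iter.simps(1) diff_zero)
  then show ?thesis
    by (simp add: sqrt_one_minus_def convergent_LIMSEQ_iff)
qed

lemma sqrt_one_minus_square: "sqrt_one_minus B o\<^sub>L sqrt_one_minus B = id_blinfun - B"
proof -
  note bil = bounded_bilinear_blinfun_compose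
  define Y where "Y = id_blinfun - sqrt_one_minus B"
  have lim: "sqrt_iter B \<longlonglongrightarrow> Y"
    using sqrt_iter_tendsto by (simp add: Y_def)
  have "(\<lambda>n. sqrt_iter B (Suc n)) \<longlonglongrightarrow> (1/2) *\<^sub>R (B + (Y o\<^sub>L Y))"
    unfolding sqrt_iter.simps by (intro tendsto_intros bounded_bilinear.tendsto[OF bil] lim)
  then have "Y = (1/2) *\<^sub>R (B + (Y o\<^sub>L Y))"
    using LIMSEQ_Suc[OF lim] LIMSEQ_unique by blast
  then have "2 *\<^sub>R Y = B + (Y o\<^sub>L Y)"
    by (metis divide_self_if one_add_one scaleR_half_double scaleR_scaleR scaleR_2 scaleR_right_distrib)
  moreover have "sqrt_one_minus B = id_blinfun - Y"
    by (simp add: Y_def)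
  moreover have "(id_blinfun - Y) o\<^sub>L (id_blinfun - Y) = id_blinfun - 2 *\<^sub>R Y + (Y o\<^sub>L Y)"
    by (rule blinfun_eqI)
      (simp add: blinfun.diff_left blinfun.diff_right blinfun.add_left blinfun.scaleR_left scaleR_2)
  ultimately show ?thesis by simp
qed

lemma norm_one_minus_sqrt_one_minus: "norm (id_blinfun - sqrt_one_minus B) \<le> 1"
proof (rule LIMSEQ_le_const2[OF tendsto_norm[OF sqrt_iter_tendsto]])
  show "\<exists>N. \<forall>n\<ge>N. norm (sqrt_iter B n) \<le> 1"
    using norm_sqrt_iter sqrt_bound_bounds order_trans by blast
qed

end

text \<open>Each step of the iteration preserves the intertwining, and so does the norm limit. With
  \<open>B1 = B2\<close> it gives the commutation behind uniqueness of roots; with two different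
  operators it relates the two defect operators.\<close>

lemma sqrt_one_minus_intertwines:
  fixes B1 :: "'a :: banach \<Rightarrow>\<^sub>L 'a" and B2 :: "'b :: banach \<Rightarrow>\<^sub>L 'b"
  assumes "norm B1 \<le> 1" "norm B2 \<le> 1" and C: "C o\<^sub>L B1 = B2 o\<^sub>L C"
  shows "C o\<^sub>L sqrt_one_minus B1 = sqrt_one_minus B2 o\<^sub>L C"
proof -
  note bil = bounded_bilinear_blinfun_compose
  have "C o\<^sub>L sqrt_iter B1 n = sqrt_iter B2 n o\<^sub>L C" for n
  proof (induction n)
    case (Suc n)
    then have 1: "C (sqrt_iter B1 n x) = sqrt_iter B2 n (C x)" for x
      by (metis blinfun_apply_blinfun_compose)
    have 2: "C (B1 x) = B2 (C x)" for x
      using C by (metis blinfun_apply_blinfun_compose)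
    show ?case
      by (rule blinfun_eqI) (simp add: blinfun.add_left blinfun.scaleR_left blinfun.add_right
          blinfun.scaleR_right 1 2)
  qed simp
  moreover have "(\<lambda>n. C o\<^sub>L sqrt_iter B1 n) \<longlonglongrightarrow> (C o\<^sub>L (id_blinfun - sqrt_one_minus B1))"
    by (intro bounded_bilinear.tendsto[OF bil] tendsto_const sqrt_iter_tendsto assms)
  moreover have "(\<lambda>n. sqrt_iter B2 n o\<^sub>L C) \<longlonglongrightarrow> ((id_blinfun - sqrt_one_minus B2) o\<^sub>L C)"
    by (intro bounded_bilinear.tendsto[OF bil] tendsto_const sqrt_iter_tendsto assms)
  ultimately have eq: "C o\<^sub>L (id_blinfun - sqrt_one_minus B1) = (id_blinfun - sqrt_one_minus B2) o\<^sub>L C"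
    by (simp add: LIMSEQ_unique)
  have "C x - C (sqrt_one_minus B1 x) = C x - sqrt_one_minus B2 (C x)" for x
    using arg_cong[OF eq, of "\<lambda>A. A x"] by (simp add: blinfun.diff_left blinfun.diff_right)
  then show ?thesis
    by (intro blinfun_eqI) simp
qed

lemma positive_op_sqrt_one_minus:
  fixes B :: "'a :: chilbert_space \<Rightarrow>\<^sub>L 'a"
  assumes "norm B \<le> 1" "complex_linear B" and sym: "\<And>x y. inner (B x) y = inner x (B y)"
  shows "positive_op (sqrt_one_minus B)"
proof -
  define Y where "Y = id_blinfun - sqrt_one_minus B"
  have S: "sqrt_one_minus B = id_blinfun - Y"
    by (simp add: Y_def)
  have lim: "(\<lambda>n. sqrt_iter B n x) \<longlonglongrightarrow> Y x" for x
    unfolding Y_def by (intro tendsto_intros sqrt_iter_tendsto assms)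
  have cl: "complex_linear (sqrt_iter B n)" for n
    by (induction n) (auto intro!: complex_linear_scaleR complex_linear_add complex_linear_compose
        assms simp: complex_linear_def[of 0])
  have symn: "inner (sqrt_iter B n x) y = inner x (sqrt_iter B n y)" for n x y
    by (induction n arbitrary: x y)
      (auto simp: blinfun.scaleR_left blinfun.add_left inner_add_left inner_add_right sym)
  have "Y (c *\<^sub>C x) = c *\<^sub>C Y x" for c x
  proof (rule LIMSEQ_unique[OF lim])
    show "(\<lambda>n. sqrt_iter B n (c *\<^sub>C x)) \<longlonglongrightarrow> c *\<^sub>C Y x"
      unfolding complex_linearD[OF cl] by (intro bounded_linear.tendsto[OF bounded_linear_scaleC] lim)
  qed
  then have "complex_linear Y" by (simp add: complex_linear_def)
  have symY: "inner (Y x) y = inner x (Y y)" for x y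
  proof (rule LIMSEQ_unique)
    show "(\<lambda>n. inner (sqrt_iter B n x) y) \<longlonglongrightarrow> inner (Y x) y"
      by (intro tendsto_intros lim)
    show "(\<lambda>n. inner (sqrt_iter B n x) y) \<longlonglongrightarrow> inner x (Y y)"
      unfolding symn by (intro tendsto_intros lim)
  qed
  have "inner (Y x) x \<le> inner x x" for x
  proof -
    have "norm (Y x) \<le> norm x"
      using norm_blinfun[of Y x] norm_one_minus_sqrt_one_minus[OF assms(1)]
      by (metis Y_def mult_left_le_one_le norm_ge_zero order_trans)
    then have "norm (Y x) * norm x \<le> norm x * norm x"
      by (intro mult_right_mono) auto
    then show ?thesis
      using norm_cauchy_schwarz[of "Y x" x] by (simp add: power2_norm_eq_inner[symmetric] power2_eq_square)
  qed
  with \<open>complex_linear Y\<close> symY show ?thesis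
    unfolding S by (intro positive_opI complex_linear_diff complex_linear_id)
      (auto simp: blinfun.diff_left inner_diff_left inner_diff_right)
qed

theorem op_sqrt_one_minus:
  fixes B :: "'a :: chilbert_space \<Rightarrow>\<^sub>L 'a"
  assumes "norm B \<le> 1" "complex_linear B" and sym: "\<And>x y. inner (B x) y = inner x (B y)"
  shows "op_sqrt (id_blinfun - B) = sqrt_one_minus B"
  unfolding op_sqrt_def
proof (rule the_equality)
  show "positive_op (sqrt_one_minus B) \<and> sqrt_one_minus B o\<^sub>L sqrt_one_minus B = id_blinfun - B"
    using positive_op_sqrt_one_minus[OF assms] sqrt_one_minus_square[OF assms(1)] by blast
  fix S assume S: "positive_op S \<and> S o\<^sub>L S = id_blinfun - B"
  \<comment> \<open>A competing root \<open>S\<close> commutes with its own square, hence with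
    \<open>B\<close> and with the root built from \<open>B\<close>; this is the commutation required
    for uniqueness.\<close>
  have B: "B x = x - S (S x)" for x
  proof -
    have "S (S x) = (id_blinfun - B) x"
      using S by (metis blinfun_apply_blinfun_compose)
    then show ?thesis
      by (simp add: blinfun.diff_left)
  qed
  have "S o\<^sub>L B = B o\<^sub>L S"
    by (rule blinfun_eqI) (simp add: B blinfun.diff_right)
  then have comm: "S o\<^sub>L sqrt_one_minus B = sqrt_one_minus B o\<^sub>L S"
    by (rule sqrt_one_minus_intertwines[OF assms(1) assms(1)])
  show "S = sqrt_one_minus B"
    using S sqrt_one_minus_square[OF assms(1)]
    by (intro positive_square_root_unique[OF _ positive_op_sqrt_one_minus[OF assms] _ comm]) simp_all
qed

section \<open>Row operators, uniform boundedness and finite-dimensional ranges\<close>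

lemma adj_adj:
  fixes A :: "'a :: chilbert_space \<Rightarrow>\<^sub>L 'b :: chilbert_space"
  assumes "complex_linear A"
  shows "adj (adj A) = A"
  by (rule adj_unique) (simp add: cinner_adj_left assms)

lemma norm_adj:
  fixes A :: "'a :: chilbert_space \<Rightarrow>\<^sub>L 'b :: chilbert_space"
  assumes "complex_linear A"
  shows "norm (adj A) = norm A"
  using norm_adj_le[OF assms] norm_adj_le[OF complex_linear_adj[OF assms]] by (simp add: adj_adj assms)

lemma adj_diff:
  fixes A :: "'a :: chilbert_space \<Rightarrow>\<^sub>L 'b :: chilbert_space"
  assumes "complex_linear A" "complex_linear B"
  shows "adj (A - B) = adj A - adj B"
  by (rule adj_unique) (simp add: blinfun.diff_left cinner_diff_left cinner_diff_right
      cinner_adj_right assms)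

section \<open>Coordinate vectors of the direct sum\<close>

lift_definition hsum_single :: "'i \<Rightarrow> 'h :: real_normed_vector \<Rightarrow> ('i, 'h) hsum"
  is "\<lambda>i h j. if j = i then h else 0"
  by (rule finite_nonzero_values_imp_summable_on) (auto intro: finite_subset[of _ "{_}"])

lemma hsum_nth_single: "hsum_nth (hsum_single i h) j = (if j = i then h else 0)"
  by (simp add: hsum_single.rep_eq)

lemma hsum_nth_sum: "hsum_nth (\<Sum>j\<in>F. f j) i = (\<Sum>j\<in>F. hsum_nth (f j) i)"
  by (induction F rule: infinite_finite_induct) (auto simp: zero_hsum.rep_eq plus_hsum.rep_eq)

lemma hsum_eqI: "(\<And>i. hsum_nth x i = hsum_nth y i) \<Longrightarrow> x = y"
  by (simp add: hsum_nth_inject[symmetric] fun_eq_iff)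

lemma cinner_hsum_single: "cinner (hsum_single i h) x = cinner h (hsum_nth x i)"
  for x :: "('i, 'h :: chilbert_space) hsum"
proof -
  have "cinner (hsum_single i h) x = (\<Sum>\<^sub>\<infinity>j\<in>{i}. cinner h (hsum_nth x j))"
    unfolding cinner_hsum.rep_eq hsum_nth_single by (rule infsum_cong_neutral) auto
  then show ?thesis by simp
qed

lemma inner_hsum_single: "inner (hsum_single i h) x = inner h (hsum_nth x i)"
  for x :: "('i, 'h :: chilbert_space) hsum"
  by (simp add: Re_cinner[symmetric] cinner_hsum_single)

text \<open>Pythagoras: the squared distance from \<open>x\<close> to a finite partial sum is the
  remaining tail of the square sum.\<close>

lemma hsum_single_has_sum:
  fixes x :: "('i, 'h :: chilbert_space) hsum"
  shows "((\<lambda>i. hsum_single i (hsum_nth x i)) has_sum x) UNIV"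
  unfolding has_sum_def
proof (rule Lim_null[THEN iffD2], rule tendsto_norm_zero_cancel)
  let ?y = "\<lambda>F. \<Sum>i\<in>F. hsum_single i (hsum_nth x i)"
  have eq: "(norm (?y F - x))\<^sup>2 = (norm x)\<^sup>2 - (\<Sum>i\<in>F. (norm (hsum_nth x i))\<^sup>2)" if "finite F" for F
  proof -
    have "inner (?y F) x = (\<Sum>i\<in>F. (norm (hsum_nth x i))\<^sup>2)"
      "inner (?y F) (?y F) = (\<Sum>i\<in>F. (norm (hsum_nth x i))\<^sup>2)"
      using that by (simp_all add: inner_sum_left inner_hsum_single hsum_nth_sum hsum_nth_single
          power2_norm_eq_inner)
    then show ?thesis
      by (simp add: power2_norm_eq_inner inner_diff_left inner_diff_right inner_commute)
  qed
  have "((\<lambda>F. \<Sum>i\<in>F. (norm (hsum_nth x i))\<^sup>2) \<longlongrightarrow> (norm x)\<^sup>2) (finite_subsets_at_top UNIV)"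
    unfolding norm_hsum_sq using has_sum_infsum[OF norm_hsum_summable[of x]] by (simp add: has_sum_def)
  then have "((\<lambda>F. sqrt ((norm x)\<^sup>2 - (\<Sum>i\<in>F. (norm (hsum_nth x i))\<^sup>2)))
      \<longlongrightarrow> sqrt ((norm x)\<^sup>2 - (norm x)\<^sup>2)) (finite_subsets_at_top UNIV)"
    by (intro tendsto_intros)
  moreover have "\<forall>\<^sub>F F in finite_subsets_at_top UNIV.
      sqrt ((norm x)\<^sup>2 - (\<Sum>i\<in>F. (norm (hsum_nth x i))\<^sup>2)) = norm (?y F - x)"
    by (rule eventually_finite_subsets_at_top_weakI) (simp add: eq[symmetric])
  ultimately show "((\<lambda>F. norm (?y F - x)) \<longlongrightarrow> 0) (finite_subsets_at_top UNIV)"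
    by (simp add: filterlim_cong)
qed

section \<open>Row operators as adjoints of columns, in a form common to \<open>row_op\<close> and
  \<open>scalar_row_op\<close>\<close>

definition row_operator ::
  "('i \<Rightarrow> 'h \<Rightarrow>\<^sub>L 'g) \<Rightarrow> ('i, 'h :: chilbert_space) hsum \<Rightarrow>\<^sub>L 'g :: chilbert_space"
  where "row_operator A = Blinfun (\<lambda>h. \<Sum>\<^sub>\<infinity>i. A i (hsum_nth h i))"

text \<open>The bound is placed on the adjoint entries because that makes the column contractive at
  once; the row is then obtained as its adjoint, with no separate estimate of the series.\<close>

locale row_contraction =
  fixes A :: "'i \<Rightarrow> 'h :: chilbert_space \<Rightarrow>\<^sub>L 'g :: chilbert_space"
  assumes complex_linear_entry: "complex_linear (A i)"
    and adj_bound: "finite F \<Longrightarrow> (\<Sum>i\<in>F. (norm (adj (A i) y))\<^sup>2) \<le> (norm y)\<^sup>2"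
begin

definition column :: "'g \<Rightarrow>\<^sub>L ('i, 'h) hsum"
  where "column = Blinfun (\<lambda>y. Abs_hsum (\<lambda>i. adj (A i) y))"

lemma hsum_nth_column: "hsum_nth (column y) i = adj (A i) y"
  and norm_column: "norm column \<le> 1"
proof -
  define V where "V y = Abs_hsum (\<lambda>i. adj (A i) y)" for y
  have nth: "hsum_nth (V y) = (\<lambda>i. adj (A i) y)" for y
    unfolding V_def
  proof (rule Abs_hsum_inverse, rule CollectI)
    show "(\<lambda>i. (norm (adj (A i) y))\<^sup>2) summable_on UNIV"
      by (rule nonneg_bdd_above_summable_on)
        (use adj_bound[of _ y] in \<open>auto intro!: bdd_aboveI[of _ "(norm y)\<^sup>2"]\<close>)
  qed
  have norm: "norm (V y) \<le> norm y" for y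
    by (rule norm_hsum_le) (use adj_bound[of _ y] in \<open>auto simp: nth\<close>)
  have "bounded_linear V"
    by (rule bounded_linear_intro[of _ 1])
      (auto intro!: hsum_eqI norm simp: nth plus_hsum.rep_eq scaleR_hsum.rep_eq blinfun.add_right
        blinfun.scaleR_right)
  then have ap: "blinfun_apply column = V"
    by (simp add: column_def V_def[abs_def] bounded_linear_Blinfun_apply)
  show "hsum_nth (column y) i = adj (A i) y"
    by (simp add: ap nth)
  show "norm column \<le> 1"
    by (rule norm_blinfun_bound) (auto simp: ap norm)
qed

lemma complex_linear_column: "complex_linear column"
  unfolding complex_linear_def
  by (auto intro!: hsum_eqI simp: hsum_nth_column scaleC_hsum.rep_eq
      complex_linearD[OF complex_linear_adj[OF complex_linear_entry]])

lemma adj_column_single: "adj column (hsum_single i h) = A i h"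
proof (rule cinner_eqI)
  fix x
  have "cinner x (adj column (hsum_single i h)) = cinner (column x) (hsum_single i h)"
    by (simp add: cinner_adj_right complex_linear_column)
  also have "\<dots> = cinner (adj (A i) x) h"
    by (metis cinner_hsum_single cinner_commute hsum_nth_column)
  also have "\<dots> = cinner x (A i h)"
    by (simp add: cinner_adj_left complex_linear_entry)
  finally show "cinner x (adj column (hsum_single i h)) = cinner x (A i h)" .
qed

lemma adj_column_has_sum: "((\<lambda>i. A i (hsum_nth h i)) has_sum adj column h) UNIV"
proof -
  have "((adj column \<circ> (\<lambda>i. hsum_single i (hsum_nth h i))) has_sum adj column h) UNIV"
    by (rule has_sum_comm_additive)
      (auto simp: hsum_single_has_sum Modules.additive_def blinfun.add_right intro!: tendsto_intros)
  then show ?thesis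
    by (simp add: o_def adj_column_single)
qed

text \<open>The pointwise sum is that of a known bounded operator, so \<open>Blinfun\<close> in
  \<open>row_operator\<close> is applied to a genuinely bounded linear map.\<close>

lemma row_operator_eq_adj_column: "row_operator A = adj column"
  using infsumI[OF adj_column_has_sum] by (simp add: row_operator_def blinfun_apply_inverse)

lemma row_operator_has_sum: "((\<lambda>i. A i (hsum_nth h i)) has_sum row_operator A h) UNIV"
  unfolding row_operator_eq_adj_column by (rule adj_column_has_sum)

lemma row_operator_single: "row_operator A (hsum_single i h) = A i h"
  by (simp add: row_operator_eq_adj_column adj_column_single)

lemma complex_linear_row_operator: "complex_linear (row_operator A)"
  by (simp add: row_operator_eq_adj_column complex_linear_adj complex_linear_column)

lemma norm_row_operator: "norm (row_operator A) \<le> 1"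
  by (simp add: row_operator_eq_adj_column norm_adj complex_linear_column norm_column)

lemma hsum_nth_adj_row_operator: "hsum_nth (adj (row_operator A) y) i = adj (A i) y"
  by (simp add: row_operator_eq_adj_column adj_adj complex_linear_column hsum_nth_column)

end

section \<open>Uniform boundedness and a quantitative dual of surjectivity\<close>

lemma uniform_boundedness_inner:
  fixes Y :: "nat \<Rightarrow> 'a :: {real_inner, complete_space}"
  assumes "\<And>x. \<exists>K. \<forall>n. \<bar>inner x (Y n)\<bar> \<le> K"
  shows "\<exists>K. \<forall>n. norm (Y n) \<le> K"
proof -
  define E where "E N = {x. \<forall>n. \<bar>inner x (Y n)\<bar> \<le> real N}" for N :: nat
  have "closed (E N)" for N
  proof -
    have "E N = (\<Inter>n. {x. \<bar>inner x (Y n)\<bar> \<le> real N})"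
      by (auto simp: E_def)
    then show ?thesis
      by (auto intro!: closed_Collect_le continuous_intros)
  qed
  have cover: "(\<Union>N. E N) = UNIV"
  proof -
    have "\<exists>N. x \<in> E N" for x
    proof -
      obtain K where "\<forall>n. \<bar>inner x (Y n)\<bar> \<le> K"
        using assms by blast
      then have "x \<in> E (nat \<lceil>K\<rceil>)"
        unfolding E_def by (auto intro: order_trans real_nat_ceiling_ge)
      then show ?thesis by blast
    qed
    then show ?thesis by blast
  qed
  have "\<exists>N. interior (E N) \<noteq> {}"
  \<comment> \<open>Otherwise Baire's theorem would give the union of the closed sets
    \<open>E N\<close>, which is the whole space, an empty interior.\<close>
  proof (rule ccontr)
    assume "\<not> ?thesis"
    then have "Met_TC.mtopology interior_of \<Union>(range E) = ({} :: 'a set)"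
      by (intro Met_TC.metric_Baire_category_alt)
        (use \<open>\<And>N. closed (E N)\<close> in \<open>auto simp: complete_UNIV interior_of_eq interior_def\<close>)
    then show False
      by (simp add: cover)
  qed
  then obtain N x0 r where r: "0 < r" "ball x0 r \<subseteq> E N"
    by (meson ex_in_conv mem_interior)
  have "norm (Y n) \<le> 4 * real N / r" for n
  proof (cases "Y n = 0")
    case False
    \<comment> \<open>A vector of length \<open>r / 2\<close> in the direction of
      \<open>Y n\<close>: it stays inside the ball, and its inner product with \<open>Y n\<close> is
      \<open>r / 2\<close> times the norm to be bounded.\<close>
    define v where "v = (r / (2 * norm (Y n))) *\<^sub>R Y n"
    have "norm v < r"
      using False r by (simp add: v_def)
    then have "x0 + v \<in> E N" "x0 \<in> E N"
      using r by (auto simp: dist_norm subset_iff)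
    then have "\<bar>inner (x0 + v) (Y n)\<bar> \<le> real N" "\<bar>inner x0 (Y n)\<bar> \<le> real N"
      by (auto simp: E_def)
    then have "inner v (Y n) \<le> 2 * real N"
      by (simp add: inner_add_left)
    moreover have "inner v (Y n) = r / 2 * norm (Y n)"
      using False by (simp add: v_def power2_norm_eq_inner[symmetric] power2_eq_square)
    ultimately show ?thesis
      using r by (simp add: field_simps)
  qed (use r in auto)
  then show ?thesis by blast
qed

text \<open>If every \<open>c\<close> failed, rescaled counterexamples \<open>Y n\<close> of norm
  \<open>n + 1\<close> would have adjoint images of norm at most 1. Writing \<open>h\<close> through
  the \<open>A i\<close> bounds \<open>inner h (Y n)\<close> in \<open>n\<close>, so uniform
  boundedness is contradicted.\<close>

lemma surjective_row_adj_bounded_below: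
  fixes A :: "'d :: finite \<Rightarrow> 'h :: chilbert_space \<Rightarrow>\<^sub>L 'g :: chilbert_space"
  assumes cl: "\<And>i. complex_linear (A i)" and surj: "\<And>h. \<exists>x. h = (\<Sum>i\<in>UNIV. A i (x i))"
  shows "\<exists>c>0. \<forall>y. c * (norm y)\<^sup>2 \<le> (\<Sum>i\<in>UNIV. (norm (adj (A i) y))\<^sup>2)"
proof (rule ccontr)
  assume "\<not> ?thesis"
  then have "\<exists>y. (\<Sum>i\<in>UNIV. (norm (adj (A i) y))\<^sup>2) < 1 / (real (Suc n))\<^sup>2 * (norm y)\<^sup>2" for n
    by (metis not_le zero_less_divide_1_iff zero_less_power of_nat_0_less_iff zero_less_Suc)
  then obtain y where y: "\<And>n. (\<Sum>i\<in>UNIV. (norm (adj (A i) (y n)))\<^sup>2)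
      < 1 / (real (Suc n))\<^sup>2 * (norm (y n))\<^sup>2"
    by metis
  \<comment> \<open>Strictness of the inequality excludes the zero vector.\<close>
  have nz: "0 < norm (y n)" for n
    using y[of n] by auto
  define Y where "Y n = (real (Suc n) / norm (y n)) *\<^sub>R y n" for n
  have norm_Y: "norm (Y n) = real (Suc n)" for n
    using nz[of n] by (simp add: Y_def)
  have adj_Y: "norm (adj (A i) (Y n)) \<le> 1" for i n
  proof -
    define s where "s = real (Suc n) / norm (y n)"
    have s: "0 < s" "s\<^sup>2 * (1 / (real (Suc n))\<^sup>2 * (norm (y n))\<^sup>2) = 1"
      using nz[of n] by (auto simp: s_def power2_eq_square)
    have "(norm (adj (A i) (Y n)))\<^sup>2 = s\<^sup>2 * (norm (adj (A i) (y n)))\<^sup>2"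
      by (simp add: Y_def s_def blinfun.scaleR_right power_mult_distrib power_divide)
    also have "\<dots> \<le> s\<^sup>2 * (\<Sum>i\<in>UNIV. (norm (adj (A i) (y n)))\<^sup>2)"
      by (intro mult_left_mono member_le_sum) auto
    also have "\<dots> \<le> 1"
      using mult_left_mono[OF less_imp_le[OF y[of n]], of "s\<^sup>2"] unfolding s(2) by simp
    finally show ?thesis
      by (simp add: power2_le_imp_le)
  qed
  have "\<exists>K. \<forall>n. \<bar>inner h (Y n)\<bar> \<le> K" for h
  proof -
    obtain x where x: "h = (\<Sum>i\<in>UNIV. A i (x i))"
      using surj by blast
    have "\<bar>inner h (Y n)\<bar> \<le> (\<Sum>i\<in>UNIV. norm (x i))" for n
    proof -
      have "inner h (Y n) = (\<Sum>i\<in>UNIV. inner (x i) (adj (A i) (Y n)))"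
        by (simp add: x inner_sum_left inner_adj_right cl)
      also have "\<bar>\<dots>\<bar> \<le> (\<Sum>i\<in>UNIV. norm (x i))"
      proof (rule order_trans[OF sum_abs], rule sum_mono)
        show "\<bar>inner (x i) (adj (A i) (Y n))\<bar> \<le> norm (x i)" for i
          using Cauchy_Schwarz_ineq2[of "x i" "adj (A i) (Y n)"] adj_Y[of i n]
          by (meson mult_left_le norm_ge_zero order_trans)
      qed
      finally show ?thesis .
    qed
    then show ?thesis by blast
  qed
  then obtain K where K: "\<And>n. real (Suc n) \<le> K"
    using uniform_boundedness_inner[of Y] norm_Y by metis
  obtain n where "K < real n"
    using reals_Archimedean2 by blast
  then show False
    using K[of n] by simp
qed

section \<open>Finite-dimensional ranges are closed\<close>

lemma closed_complex_span:
  fixes B :: "'a :: chilbert_space set"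
  assumes "finite B"
  shows "closed (complex_vector.span B)"
  using assms
proof (induction B)
  case (insert b B)
  define S where "S = complex_vector.span B"
  have S: "closed S" and sub: "complex_vector.subspace S"
    using insert by (auto simp: S_def)
  show ?case
  proof (cases "b \<in> S")
    case True
    then show ?thesis
      using S by (simp add: S_def complex_vector.span_redundant)
  next
    case False
    then obtain \<delta> where "0 < \<delta>" "ball b \<delta> \<subseteq> - S"
      using S(1) unfolding closed_def open_contains_ball by auto
    then have \<delta>: "0 < \<delta>" "\<And>v. v \<in> S \<Longrightarrow> \<delta> \<le> dist b v"
      by (auto simp: subset_iff not_less[symmetric])
    \<comment> \<open>As \<open>b\<close> has distance at least \<delta> from \<open>S\<close>, the
      coefficient of \<open>b\<close> is controlled by the norm of the vector. Coefficients along a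
      convergent sequence are therefore Cauchy.\<close>
    have low: "cmod c * \<delta> \<le> norm (v + c *\<^sub>C b)" if "v \<in> S" for c v
    proof (cases "c = 0")
      case False
      have "v + c *\<^sub>C b = c *\<^sub>C (b - (- inverse c) *\<^sub>C v)"
        using False by (simp add: scaleC_add_right scaleC_scaleC complex_vector.scale_minus_left
            scaleC_diff_right)
      moreover have "\<delta> \<le> norm (b - (- inverse c) *\<^sub>C v)"
        using \<delta>(2)[OF complex_vector.subspace_scale[OF sub that]] by (simp only: dist_norm)
      ultimately show ?thesis
        by (metis norm_scaleC mult_left_mono norm_ge_zero)
    qed simp
    show ?thesis
      unfolding closed_sequential_limits
    proof (intro allI impI, elim conjE)
      fix f x assume f: "\<forall>n. f n \<in> complex_vector.span (insert b B)" and lim: "f \<longlonglongrightarrow> x"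
      have "\<exists>c. f n - c *\<^sub>C b \<in> S" for n
        using f by (simp only: S_def complex_vector.span_breakdown_eq)
      then obtain c where c: "\<And>n. f n - c n *\<^sub>C b \<in> S" by metis
      have "cmod (c m - c n) * \<delta> \<le> norm (f m - f n)" for m n
      proof -
        have eq: "f m - f n = ((f m - c m *\<^sub>C b) - (f n - c n *\<^sub>C b)) + (c m - c n) *\<^sub>C b"
          by (simp add: complex_vector.scale_left_diff_distrib)
        then show ?thesis
          using low[OF complex_vector.subspace_diff[OF sub c[of m] c[of n]], of "c m - c n"]
          by (simp only: eq)
      qed
      note lip = this
      have "Cauchy c"
      proof (rule CauchyI)
        fix e :: real assume "0 < e"
        then obtain M where M: "\<forall>m\<ge>M. \<forall>n\<ge>M. norm (f m - f n) < e * \<delta>"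
          using \<delta> LIMSEQ_imp_Cauchy[OF lim] CauchyD[of f "e * \<delta>"] by auto
        have "norm (c m - c n) < e" if "M \<le> m" "M \<le> n" for m n
          using M that lip[of m n] \<delta> by (meson mult_less_cancel_right_pos order_le_less_trans)
        then show "\<exists>M. \<forall>m\<ge>M. \<forall>n\<ge>M. norm (c m - c n) < e" by blast
      qed
      then obtain c0 where c0: "c \<longlonglongrightarrow> c0"
        using Cauchy_convergent convergent_def by blast
      have "bounded_linear (\<lambda>c. c *\<^sub>C b)"
      proof (rule bounded_linear_intro)
        show "(c + c') *\<^sub>C b = c *\<^sub>C b + c' *\<^sub>C b" for c c'
          by (rule scaleC_add_left)
        show "(r *\<^sub>R c) *\<^sub>C b = r *\<^sub>R c *\<^sub>C b" for r c
          unfolding scaleR_conv_of_real scaleC_scaleC[symmetric] scaleC_of_real ..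
        show "norm (c *\<^sub>C b) \<le> norm c * norm b" for c
          by (simp only: norm_scaleC order_refl)
      qed
      then have "(\<lambda>n. f n - c n *\<^sub>C b) \<longlonglongrightarrow> x - c0 *\<^sub>C b"
        by (intro tendsto_diff lim bounded_linear.tendsto[OF _ c0])
      then have "x - c0 *\<^sub>C b \<in> S"
        by (rule closed_sequentially[OF S(1) c])
      then show "x \<in> complex_vector.span (insert b B)"
        unfolding complex_vector.span_breakdown_eq S_def by (rule exI)
    qed
  qed
qed simp

text \<open>\<open>complex_finite_dim\<close> only places the range inside a finite span. An
  independent set taken from the range itself is finite and spans it exactly.\<close>

lemma closed_op_range_finite_dim:
  fixes A :: "'a :: chilbert_space \<Rightarrow>\<^sub>L 'b :: chilbert_space"
  assumes "complex_linear A" "complex_finite_dim (op_range A)"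
  shows "closed (op_range A)"
proof -
  have sub: "complex_vector.subspace (op_range A)"
    unfolding op_range_def
  proof (rule complex_vector.subspaceI)
    show "0 \<in> range A"
      by (rule range_eqI[of _ _ 0]) simp
    show "x + y \<in> range A" if xy: "x \<in> range A" "y \<in> range A" for x y
    proof -
      from xy obtain u v where "x = A u" "y = A v" by blast
      then show ?thesis
        by (intro range_eqI[of _ _ "u + v"]) (simp add: blinfun.add_right)
    qed
    show "c *\<^sub>C x \<in> range A" if x: "x \<in> range A" for c x
    proof -
      from x obtain u where "x = A u" by blast
      then show ?thesis
        by (intro range_eqI[of _ _ "c *\<^sub>C u"]) (simp add: complex_linearD[OF assms(1)])
    qed
  qed
  obtain C where C: "finite C" "op_range A \<subseteq> complex_vector.span C"
    using assms(2) by (auto simp: complex_finite_dim_def)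
  obtain B where B: "B \<subseteq> op_range A" "complex_vector.independent B" "op_range A \<subseteq> complex_vector.span B"
    using complex_vector.maximal_independent_subset by blast
  have "finite B"
    using complex_vector.independent_span_bound[OF C(1) B(2)] B C by blast
  moreover have "op_range A = complex_vector.span B"
    using B sub by (simp add: complex_vector.span_minimal subset_antisym)
  ultimately show ?thesis
    by (simp add: closed_complex_span)
qed

section \<open>Multinomial sums and the coefficients of the kernel\<close>

text \<open>Plain functions are used instead of \<open>multiindex\<close>, since lowering an entry
  may lead to the zero index.\<close>

definition degree_fun :: "('d::finite \<Rightarrow> nat) \<Rightarrow> nat"
  where "degree_fun \<alpha> = (\<Sum>i\<in>UNIV. \<alpha> i)"

definition multinomial_term :: "('d::finite \<Rightarrow> real) \<Rightarrow> ('d \<Rightarrow> nat) \<Rightarrow> real"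
  where "multinomial_term x \<alpha> = fact (degree_fun \<alpha>) / (\<Prod>i\<in>UNIV. fact (\<alpha> i)) * (\<Prod>i\<in>UNIV. x i ^ \<alpha> i)"

lemma multinomial_term_nonneg: "(\<And>i. 0 \<le> x i) \<Longrightarrow> 0 \<le> multinomial_term x \<alpha>"
  unfolding multinomial_term_def by (intro mult_nonneg_nonneg divide_nonneg_nonneg prod_nonneg) auto

lemma degree_fun_decrement:
  assumes "0 < \<alpha> i"
  shows "degree_fun \<alpha> = Suc (degree_fun (\<alpha>(i := \<alpha> i - 1)))"
  using assms by (simp add: degree_fun_def sum.remove[of UNIV i])

text \<open>Pascal's rule for multinomial coefficients: the \<open>i\<close>-th summand is
  \<open>\<alpha> i / (n + 1)\<close> times the left-hand side, and the entries of \<alpha> add up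
  to \<open>n + 1\<close>.\<close>

lemma multinomial_term_decrement:
  assumes "degree_fun \<alpha> = Suc n"
  shows "multinomial_term x \<alpha> = (\<Sum>i | 0 < \<alpha> i. x i * multinomial_term x (\<alpha>(i := \<alpha> i - 1)))"
proof -
  define P where "P = (\<Prod>i\<in>UNIV. fact (\<alpha> i) :: real)"
  define X where "X = (\<Prod>i\<in>UNIV. x i ^ \<alpha> i)"
  have P: "P \<noteq> 0"
    by (simp add: P_def)
  have step: "x i * multinomial_term x (\<alpha>(i := \<alpha> i - 1)) = real (\<alpha> i) * (fact n / P * X)"
    if "0 < \<alpha> i" for i
  proof -
    obtain m where m: "\<alpha> i = Suc m"
      using \<open>0 < \<alpha> i\<close> gr0_implies_Suc by blast
    have d: "degree_fun (\<alpha>(i := m)) = n"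
      using degree_fun_decrement[of \<alpha> i] that assms m by simp
    define P' where "P' = (\<Prod>j\<in>UNIV - {i}. fact (\<alpha> j) :: real)"
    define X' where "X' = (\<Prod>j\<in>UNIV - {i}. x j ^ \<alpha> j)"
    have P': "P' \<noteq> 0"
      by (simp add: P'_def)
    have "P = fact (Suc m) * P'" "X = x i ^ Suc m * X'"
      by (simp_all only: P_def X_def P'_def X'_def m[symmetric] prod.remove[of UNIV i] finite UNIV_I)
    moreover have "(\<Prod>j\<in>UNIV. fact ((\<alpha>(i := \<alpha> i - 1)) j)) = fact m * P'"
      "(\<Prod>j\<in>UNIV. x j ^ (\<alpha>(i := \<alpha> i - 1)) j) = x i ^ m * X'"
      by (simp_all add: P'_def X'_def prod.remove[of UNIV i] m)
    ultimately show ?thesis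
      using P' by (simp add: multinomial_term_def d m field_simps del: of_nat_Suc)
  qed
  have "(\<Sum>i | 0 < \<alpha> i. x i * multinomial_term x (\<alpha>(i := \<alpha> i - 1)))
      = (\<Sum>i | 0 < \<alpha> i. real (\<alpha> i) * (fact n / P * X))"
    by (intro sum.cong refl step) simp
  also have "\<dots> = (\<Sum>i\<in>UNIV. real (\<alpha> i) * (fact n / P * X))"
    by (rule sum.mono_neutral_left) auto
  also have "\<dots> = real (degree_fun \<alpha>) * (fact n / P * X)"
    by (simp only: degree_fun_def of_nat_sum sum_distrib_right)
  also have "\<dots> = multinomial_term x \<alpha>"
    by (simp add: multinomial_term_def assms P_def X_def field_simps)
  finally show ?thesis by simp
qed

text \<open>The multinomial theorem as an inequality, for any finite family of one degree. Pascal's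
  rule reduces the degree, and lowering the \<open>i\<close>-th entry is injective where that entry
  is positive.\<close>

lemma sum_multinomial_term_le:
  assumes x: "\<And>i. 0 \<le> x i" and "finite F" "\<And>\<alpha>. \<alpha> \<in> F \<Longrightarrow> degree_fun \<alpha> = n"
  shows "(\<Sum>\<alpha>\<in>F. multinomial_term x \<alpha>) \<le> (\<Sum>i\<in>UNIV. x i) ^ n"
  using assms(2,3)
proof (induction n arbitrary: F)
  case 0
  have "F \<subseteq> {\<lambda>_. 0}"
    using 0(2) by (auto simp: degree_fun_def fun_eq_iff)
  then have "(\<Sum>\<alpha>\<in>F. multinomial_term x \<alpha>) \<le> (\<Sum>\<alpha>\<in>{\<lambda>_. 0}. multinomial_term x \<alpha>)"
    by (intro sum_mono2) (auto intro: multinomial_term_nonneg x)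
  then show ?case
    by (simp add: multinomial_term_def degree_fun_def)
next
  case (Suc n)
  let ?dec = "\<lambda>i \<alpha>. \<alpha>(i := \<alpha> i - 1)"
  have "(\<Sum>\<alpha>\<in>F. multinomial_term x \<alpha>)
      = (\<Sum>\<alpha>\<in>F. \<Sum>i | 0 < \<alpha> i. x i * multinomial_term x (?dec i \<alpha>))"
    by (rule sum.cong[OF refl multinomial_term_decrement[OF Suc.prems(2)]])
  also have "\<dots> = (\<Sum>i\<in>UNIV. \<Sum>\<alpha> | \<alpha> \<in> F \<and> 0 < \<alpha> i. x i * multinomial_term x (?dec i \<alpha>))"
    using sum.swap_restrict[of F UNIV "\<lambda>\<alpha> i. x i * multinomial_term x (?dec i \<alpha>)" "\<lambda>\<alpha> i. 0 < \<alpha> i"]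
    by (simp add: Suc.prems(1))
  also have "\<dots> \<le> (\<Sum>i\<in>UNIV. x i * (\<Sum>i\<in>UNIV. x i) ^ n)"
  proof (rule sum_mono)
    fix i
    let ?G = "{\<alpha> \<in> F. 0 < \<alpha> i}"
    have "inj_on (?dec i) ?G"
    proof (rule inj_onI, rule ext)
      fix \<alpha> \<beta> j assume *: "\<alpha> \<in> ?G" "\<beta> \<in> ?G" "?dec i \<alpha> = ?dec i \<beta>"
      have "?dec i \<alpha> j = ?dec i \<beta> j"
        by (rule fun_cong[OF *(3)])
      then show "\<alpha> j = \<beta> j"
        using *(1,2) by (cases "j = i") auto
    qed
    then have "(\<Sum>\<alpha>\<in>?G. multinomial_term x (?dec i \<alpha>)) = (\<Sum>\<beta>\<in>?dec i ` ?G. multinomial_term x \<beta>)"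
      by (simp add: sum.reindex)
    also have "\<dots> \<le> (\<Sum>i\<in>UNIV. x i) ^ n"
    proof (rule Suc.IH)
      show "degree_fun \<beta> = n" if "\<beta> \<in> ?dec i ` ?G" for \<beta>
        using that Suc.prems(2) degree_fun_decrement[of _ i] by fastforce
    qed (use Suc.prems(1) in auto)
    finally show "(\<Sum>\<alpha>\<in>?G. x i * multinomial_term x (?dec i \<alpha>)) \<le> x i * (\<Sum>i\<in>UNIV. x i) ^ n"
      unfolding sum_distrib_left[symmetric] by (intro mult_left_mono x)
  qed
  finally show ?case
    by (simp add: sum_distrib_right)
qed

section \<open>Facts about \<open>b\<close> extracted from the kernel\<close>

lemma norm_axis_eq: "norm (axis i x :: 'a::real_normed_vector ^ 'd::finite) = norm x"
proof -
  have "(\<Sum>j\<in>UNIV. (norm (axis i x $ j))\<^sup>2) = (\<Sum>j\<in>UNIV. if j = i then (norm x)\<^sup>2 else 0)"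
    by (rule sum.cong) (auto simp: axis_def)
  then show ?thesis
    by (simp add: norm_vec_def L2_set_def)
qed

lemma bracket_self: "bracket z z = complex_of_real ((norm z)\<^sup>2)"
  by (simp add: bracket_def norm_vec_def L2_set_def sum_nonneg complex_norm_square[symmetric]
      of_real_sum[symmetric] del: of_real_sum of_real_power)

context
  fixes k :: "complex ^ 'd::finite \<Rightarrow> complex ^ 'd \<Rightarrow> complex" and a b :: "nat \<Rightarrow> real"
  assumes kernel: "unitarily_invariant_CNP_kernel k a b"
begin

lemma CNP_b_nonneg: "1 \<le> n \<Longrightarrow> 0 \<le> b n"
  using kernel by (simp add: unitarily_invariant_CNP_kernel_def)

text \<open>On the diagonal at a point with \<open>(norm z)\<^sup>2 = s\<close> the kernel
  identities become real power series in \<open>s\<close>. Here \<open>g\<close> is the kernel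
  value, bounded below by the first two terms of its series.\<close>

lemma CNP_real_series:
  assumes s: "0 \<le> s" "s < 1"
  shows "\<exists>g. 1 + a 1 * s \<le> g \<and> (\<lambda>n. b (Suc n) * s ^ Suc n) sums (1 - 1 / g)"
proof -
  \<comment> \<open>\<open>undefined\<close> stands for some coordinate; only the norm of
    \<open>z\<close> matters.\<close>
  define z :: "complex ^ 'd" where "z = axis undefined (complex_of_real (sqrt s))"
  have "norm z = sqrt s"
    using s by (simp add: z_def norm_axis_eq)
  then have z: "z \<in> ball 0 1" "bracket z z = complex_of_real s"
    using s by (simp_all add: bracket_self)
  define g where "g = Re (k z z)"
  have "(\<lambda>n. complex_of_real (a n) * bracket z z ^ n) sums k z z"
    and sums_b: "(\<lambda>n. complex_of_real (b (Suc n)) * bracket z z ^ Suc n) sums (1 - 1 / k z z)"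
    using kernel z(1) unfolding unitarily_invariant_CNP_kernel_def by blast+
  then have sums_k: "(\<lambda>n. complex_of_real (a n * s ^ n)) sums k z z"
    by (simp add: z(2))
  then have "(\<lambda>n. a n * s ^ n) sums g" and im: "Im (k z z) = 0"
    using sums_Re[OF sums_k] sums_Im[OF sums_k] by (auto simp: g_def sums_iff)
  have "(\<Sum>n<2. a n * s ^ n) \<le> g"
    using \<open>(\<lambda>n. a n * s ^ n) sums g\<close> kernel s
    by (metis (no_types, lifting) sum_le_suminf sums_iff finite_lessThan mult_nonneg_nonneg
        zero_le_power less_imp_le unitarily_invariant_CNP_kernel_def)
  then have "1 + a 1 * s \<le> g"
    using kernel by (simp add: numeral_2_eq_2 unitarily_invariant_CNP_kernel_def)
  moreover have "k z z = complex_of_real g"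
    using im by (simp add: g_def complex_eq_iff)
  then have "(\<lambda>n. complex_of_real (b (Suc n) * s ^ Suc n)) sums complex_of_real (1 - 1 / g)"
    using sums_b by (simp add: z(2))
  then have "(\<lambda>n. b (Suc n) * s ^ Suc n) sums (1 - 1 / g)"
    by (simp only: sums_of_real_iff)
  ultimately show ?thesis by blast
qed

text \<open>For \<open>s < 1\<close> the partial sums are at most \<open>1 - 1 / g\<close>, hence at
  most 1; then \<open>s\<close> tends to 1 from the left.\<close>

lemma CNP_sum_b_le: "(\<Sum>n<N. b (Suc n)) \<le> 1"
proof (rule tendsto_upperbound)
  show "((\<lambda>s. \<Sum>n<N. b (Suc n) * s ^ Suc n) \<longlongrightarrow> (\<Sum>n<N. b (Suc n))) (at_left 1)"
    by (rule tendsto_eq_intros refl | simp)+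
  have "(\<Sum>n<N. b (Suc n) * s ^ Suc n) \<le> 1" if s: "0 < s" "s < 1" for s
  proof -
    obtain g where g: "1 + a 1 * s \<le> g" "(\<lambda>n. b (Suc n) * s ^ Suc n) sums (1 - 1 / g)"
      using CNP_real_series[of s] s by auto
    have "0 < a 1"
      using kernel by (simp add: unitarily_invariant_CNP_kernel_def)
    then have "0 < g"
      using g s by (smt (verit) mult_pos_pos)
    have "(\<Sum>n<N. b (Suc n) * s ^ Suc n) \<le> 1 - 1 / g"
      using g(2) s CNP_b_nonneg
      by (metis (no_types, lifting) sum_le_suminf sums_iff finite_lessThan mult_nonneg_nonneg
          zero_le_power less_imp_le le_add1 plus_1_eq_Suc)
    also have "\<dots> \<le> 1"
      using \<open>0 < g\<close> by simp
    finally show ?thesis .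
  qed
  then show "\<forall>\<^sub>F s in at_left 1. (\<Sum>n<N. b (Suc n) * s ^ Suc n) \<le> 1"
    using eventually_at_left_real[of 0 "1 :: real"] by (auto elim: eventually_mono)
qed simp

lemma CNP_b_1_pos: "0 < b 1"
  \<comment> \<open>otherwise \<open>1 - 1 / k\<close> would be of second order at \<open>0\<close>, whereas \<open>a 1 > 0\<close>\<close>
proof (rule ccontr)
  assume "\<not> 0 < b 1"
  then have b1: "b (Suc 0) = 0"
    using CNP_b_nonneg[of 1] by simp
  have a1: "0 < a 1"
    using kernel by (simp add: unitarily_invariant_CNP_kernel_def)
  \<comment> \<open>So small that \<open>s * (1 + a 1)\<close> is only half of \<open>a 1\<close>,
    whereas the estimates below would force it to be at least \<open>a 1\<close>.\<close>
  define s where "s = a 1 / (2 * (1 + a 1))"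
  have s: "0 < s" "s < 1" "s * (1 + a 1) = a 1 / 2"
    using a1 by (auto simp: s_def field_simps)
  obtain g where g: "1 + a 1 * s \<le> g" "(\<lambda>n. b (Suc n) * s ^ Suc n) sums (1 - 1 / g)"
    using CNP_real_series[of s] s by auto
  have "(\<Sum>n<N. b (Suc n) * s ^ Suc n) \<le> s\<^sup>2" for N
  proof -
    have "(\<Sum>n<N. b (Suc n) * s ^ Suc n) \<le> (\<Sum>n<N. b (Suc n) * s\<^sup>2)"
    proof (rule sum_mono)
      show "b (Suc n) * s ^ Suc n \<le> b (Suc n) * s\<^sup>2" for n
      proof (cases n)
        case (Suc m)
        then have "s ^ Suc n \<le> s\<^sup>2"
          using s by (intro power_decreasing) auto
        then show ?thesis
          using CNP_b_nonneg[of "Suc n"] by (intro mult_left_mono) auto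
      qed (simp add: b1)
    qed
    also have "\<dots> \<le> 1 * s\<^sup>2"
      unfolding sum_distrib_right[symmetric] using CNP_sum_b_le by (intro mult_right_mono) auto
    finally show ?thesis by simp
  qed
  then have "1 - 1 / g \<le> s\<^sup>2"
    using g(2) LIMSEQ_le_const2 unfolding sums_def by blast
  moreover have "0 < a 1 * s"
    using a1 s by simp
  then have "1 / g \<le> 1 / (1 + a 1 * s)"
    using g(1) by (intro divide_left_mono mult_pos_pos) auto
  ultimately have "1 \<le> s\<^sup>2 + 1 / (1 + a 1 * s)"
    by linarith
  then have "1 + a 1 * s \<le> s\<^sup>2 * (1 + a 1 * s) + 1"
    using \<open>0 < a 1 * s\<close> by (simp add: field_simps)
  then have "s * a 1 \<le> s * (s * (1 + a 1 * s))"
    by (simp add: power2_eq_square algebra_simps)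
  then have "a 1 \<le> s * (1 + a 1 * s)"
    using s by simp
  also have "\<dots> \<le> s * (1 + a 1)"
    using s a1 by (intro mult_left_mono add_left_mono) auto
  finally show False
    using s(3) a1 by simp
qed

end

section \<open>Weights of multi-indices and their uniform tails\<close>

definition mi_unit :: "'d::finite \<Rightarrow> 'd multiindex"
  where "mi_unit i = Abs_multiindex (\<lambda>j. if j = i then 1 else 0)"

lemma mi_nth_unit: "mi_nth (mi_unit i) = (\<lambda>j. if j = i then 1 else 0)"
  unfolding mi_unit_def by (rule Abs_multiindex_inverse) (auto simp: fun_eq_iff)

lemma inj_mi_unit: "inj (mi_unit :: 'd::finite \<Rightarrow> 'd multiindex)"
proof (rule injI)
  fix i j :: 'd assume "mi_unit i = mi_unit j"
  then have "mi_nth (mi_unit i) i = mi_nth (mi_unit j) i" by simp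
  then show "i = j"
    by (simp add: mi_nth_unit split: if_splits)
qed

text \<open>From here on the kernel enters only through these properties of
  \<open>b\<close>.\<close>

locale kernel_coefficients =
  fixes b :: "nat \<Rightarrow> real"
  assumes b_nonneg: "1 \<le> n \<Longrightarrow> 0 \<le> b n"
    and sum_b_le: "(\<Sum>n<N. b (Suc n)) \<le> 1"
    and b_1_pos: "0 < b 1"
begin

abbreviation degree :: "'d::finite multiindex \<Rightarrow> nat"
  where "degree \<alpha> \<equiv> degree_fun (mi_nth \<alpha>)"

lemma degree_pos: "1 \<le> degree \<alpha>"
proof -
  have "mi_nth \<alpha> \<noteq> (\<lambda>_. 0)"
    using mi_nth[of \<alpha>] by simp
  then show ?thesis
    by (auto simp: degree_fun_def fun_eq_iff Suc_le_eq intro: ccontr)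
qed

lemma mi_coeff_eq: "mi_coeff b \<alpha> = b (degree \<alpha>) * (fact (degree \<alpha>) / (\<Prod>i\<in>UNIV. fact (mi_nth \<alpha> i)))"
  by (simp add: mi_coeff_def degree_fun_def Let_def)

lemma mi_coeff_nonneg: "0 \<le> mi_coeff b \<alpha>"
  unfolding mi_coeff_eq using b_nonneg[OF degree_pos[of \<alpha>]]
  by (intro mult_nonneg_nonneg divide_nonneg_nonneg prod_nonneg) auto

text \<open>Grouping by degree leaves, in degree \<open>n\<close>, a multinomial sum of at most
  \<open>(norm z) ^ (2 * n)\<close>. Keeping the set of occurring degrees on the right makes the
  bound serve both for the total and for tails.\<close>

lemma sum_mi_coeff_le:
  fixes z :: "complex ^ 'd::finite"
  assumes "norm z \<le> 1" "finite F"
  shows "(\<Sum>\<alpha>\<in>F. mi_coeff b \<alpha> * (cmod (vec_mpow z \<alpha>))\<^sup>2) \<le> (\<Sum>n\<in>degree ` F. b n)"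
proof -
  define x where "x i = (cmod (z $ i))\<^sup>2" for i
  have x: "0 \<le> x i" for i
    by (simp add: x_def)
  have "(\<Sum>i\<in>UNIV. x i) = (norm z)\<^sup>2"
    by (simp add: x_def norm_vec_def L2_set_def sum_nonneg)
  then have sum_x: "(\<Sum>i\<in>UNIV. x i) \<le> 1" "0 \<le> (\<Sum>i\<in>UNIV. x i)"
    using assms(1) by (simp_all add: power_le_one)
  have eq: "mi_coeff b \<alpha> * (cmod (vec_mpow z \<alpha>))\<^sup>2 = b (degree \<alpha>) * multinomial_term x (mi_nth \<alpha>)" for \<alpha>
    by (simp add: mi_coeff_eq multinomial_term_def vec_mpow_def x_def prod_norm[symmetric] norm_power
        prod_power_distrib power_mult[symmetric] mult.commute[of 2])
  have "(\<Sum>\<alpha>\<in>F. mi_coeff b \<alpha> * (cmod (vec_mpow z \<alpha>))\<^sup>2)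
      = (\<Sum>n\<in>degree ` F. \<Sum>\<alpha> | \<alpha> \<in> F \<and> degree \<alpha> = n. b (degree \<alpha>) * multinomial_term x (mi_nth \<alpha>))"
    unfolding eq by (rule sum.image_gen[OF assms(2)])
  also have "\<dots> \<le> (\<Sum>n\<in>degree ` F. b n)"
  proof (rule sum_mono)
    fix n assume "n \<in> degree ` F"
    then have bn: "0 \<le> b n"
      using b_nonneg degree_pos by blast
    let ?G = "{\<alpha> \<in> F. degree \<alpha> = n}"
    have "inj_on mi_nth ?G"
      by (simp add: inj_on_def mi_nth_inject)
    then have "(\<Sum>\<alpha>\<in>?G. multinomial_term x (mi_nth \<alpha>)) = (\<Sum>\<beta>\<in>mi_nth ` ?G. multinomial_term x \<beta>)"
      by (simp add: sum.reindex)
    also have "\<dots> \<le> (\<Sum>i\<in>UNIV. x i) ^ n"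
      by (rule sum_multinomial_term_le) (use x assms(2) in auto)
    also have "\<dots> \<le> 1"
      using sum_x by (intro power_le_one)
    finally have "b n * (\<Sum>\<alpha>\<in>?G. multinomial_term x (mi_nth \<alpha>)) \<le> b n"
      using bn by (simp add: mult_left_le)
    then show "(\<Sum>\<alpha>\<in>?G. b (degree \<alpha>) * multinomial_term x (mi_nth \<alpha>)) \<le> b n"
      by (simp add: sum_distrib_left)
  qed
  finally show ?thesis .
qed

lemma sum_b_tail: "0 < e \<Longrightarrow> \<exists>N. \<forall>D. finite D \<longrightarrow> D \<subseteq> {N<..} \<longrightarrow> (\<Sum>n\<in>D. b n) \<le> e"
proof -
  assume e: "0 < e"
  have "summable (\<lambda>n. b (Suc n))"
    by (rule summableI_nonneg_bounded[of _ 1]) (auto simp: b_nonneg sum_b_le)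
  then obtain N where N: "\<And>m n. N \<le> m \<Longrightarrow> norm (\<Sum>i=m..<n. b (Suc i)) < e"
    using e unfolding summable_Cauchy by metis
  have "(\<Sum>n\<in>D. b n) \<le> e" if "finite D" "D \<subseteq> {N<..}" for D
  proof -
    define M where "M = Max (insert (Suc N) D)"
    have "D \<subseteq> {Suc N..<Suc M}"
      using that by (auto simp: M_def less_Suc_eq_le intro: Max_ge)
    then have "(\<Sum>n\<in>D. b n) \<le> (\<Sum>n=Suc N..<Suc M. b n)"
      by (intro sum_mono2) (auto intro: b_nonneg)
    also have "\<dots> = (\<Sum>n=N..<M. b (Suc n))"
      by (rule sum.shift_bounds_Suc_ivl)
    also have "\<dots> \<le> e"
      using N[of N M] by simp
    finally show ?thesis .
  qed
  then show ?thesis by blast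
qed

lemma sum_b_set_le:
  assumes "finite D" "0 \<notin> D"
  shows "(\<Sum>n\<in>D. b n) \<le> 1"
proof -
  define M where "M = Max (insert 1 D)"
  have "D \<subseteq> {Suc 0..<Suc M}"
  proof
    fix n assume "n \<in> D"
    then have "n \<noteq> 0" "n \<le> M"
      using assms by (metis, simp add: M_def)
    then show "n \<in> {Suc 0..<Suc M}" by auto
  qed
  then have "(\<Sum>n\<in>D. b n) \<le> (\<Sum>n=Suc 0..<Suc M. b n)"
    by (intro sum_mono2) (auto intro: b_nonneg)
  also have "\<dots> = (\<Sum>n<M. b (Suc n))"
    by (simp add: sum.shift_bounds_Suc_ivl atLeast0LessThan del: sum.op_ivl_Suc)
  finally show ?thesis
    using sum_b_le order_trans by blast
qed

lemma finite_degree_le: "finite {\<alpha> :: 'd::finite multiindex. degree \<alpha> \<le> N}"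
proof (rule finite_imageD)
  have "mi_nth ` {\<alpha> :: 'd multiindex. degree \<alpha> \<le> N} \<subseteq> (UNIV \<rightarrow>\<^sub>E {..N})"
  proof (intro image_subsetI PiE_I)
    fix \<alpha> :: "'d multiindex" and i assume "\<alpha> \<in> {\<alpha>. degree \<alpha> \<le> N}"
    moreover have "mi_nth \<alpha> i \<le> degree \<alpha>"
      unfolding degree_fun_def by (rule member_le_sum) auto
    ultimately show "mi_nth \<alpha> i \<in> {..N}" by simp
  qed simp
  then show "finite (mi_nth ` {\<alpha> :: 'd multiindex. degree \<alpha> \<le> N})"
    by (rule finite_subset) (simp add: finite_PiE)
qed (simp add: inj_on_def mi_nth_inject)

text \<open>These sums are the squared column norms of the difference of two scalar row operators,
  so a bound uniform in \<open>F\<close> yields norm convergence even at boundary points.\<close>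

lemma mi_coeff_diff_tendsto:
  fixes lam :: "complex ^ 'd::finite"
  assumes lam: "norm lam \<le> 1" and e: "0 < e"
  shows "\<forall>\<^sub>F z in at lam within ball 0 1. \<forall>F. finite F \<longrightarrow>
    (\<Sum>\<alpha>\<in>F. mi_coeff b \<alpha> * (cmod (vec_mpow z \<alpha> - vec_mpow lam \<alpha>))\<^sup>2) \<le> e"
proof -
  \<comment> \<open>the tails of degree above \<open>N\<close> are small uniformly on the closed ball\<close>
  obtain N where N: "\<And>D. finite D \<Longrightarrow> D \<subseteq> {N<..} \<Longrightarrow> (\<Sum>n\<in>D. b n) \<le> e / 8"
    using sum_b_tail[of "e / 8"] e by auto
  let ?t = "\<lambda>z \<alpha>. mi_coeff b \<alpha> * (cmod (vec_mpow z \<alpha> - vec_mpow lam \<alpha>))\<^sup>2"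
  define G where "G = {\<alpha> :: 'd multiindex. degree \<alpha> \<le> N}"
  have "((\<lambda>z. \<Sum>\<alpha>\<in>G. ?t z \<alpha>) \<longlongrightarrow> (\<Sum>\<alpha>\<in>G. ?t lam \<alpha>)) (at lam within ball 0 1)"
    unfolding vec_mpow_def by (intro tendsto_intros)
  then have "\<forall>\<^sub>F z in at lam within ball 0 1. (\<Sum>\<alpha>\<in>G. ?t z \<alpha>) < e / 2"
    using e by (intro order_tendstoD) auto
  moreover have "\<forall>\<^sub>F z in at lam within ball 0 1. z \<in> ball 0 1"
    by (simp add: eventually_at_filter)
  ultimately show ?thesis
  proof eventually_elim
    case (elim z)
    show ?case
    proof (intro allI impI)
      fix F :: "'d multiindex set" assume F: "finite F"
      have low: "sum (?t z) (F \<inter> G) \<le> sum (?t z) G"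
        by (rule sum_mono2) (auto simp: G_def finite_degree_le mi_coeff_nonneg)
      have "degree ` (F - G) \<subseteq> {N<..}"
        by (auto simp: G_def)
      note deg = this
      have tail: "(\<Sum>\<alpha>\<in>F - G. mi_coeff b \<alpha> * (cmod (vec_mpow w \<alpha>))\<^sup>2) \<le> e / 8" if "norm w \<le> 1"
        for w :: "complex ^ 'd"
        by (rule order_trans[OF sum_mi_coeff_le[OF that] N]) (use F deg in auto)
      have "sum (?t z) (F - G) \<le> (\<Sum>\<alpha>\<in>F - G. 2 * (mi_coeff b \<alpha> * (cmod (vec_mpow z \<alpha>))\<^sup>2)
          + 2 * (mi_coeff b \<alpha> * (cmod (vec_mpow lam \<alpha>))\<^sup>2))"
      proof (rule sum_mono)
        fix \<alpha> :: "'d multiindex"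
        let ?u = "vec_mpow z \<alpha>" and ?v = "vec_mpow lam \<alpha>"
        have "(cmod (?u - ?v))\<^sup>2 \<le> (cmod ?u + cmod ?v)\<^sup>2"
          by (intro power_mono norm_triangle_ineq4) auto
        also have "\<dots> \<le> 2 * (cmod ?u)\<^sup>2 + 2 * (cmod ?v)\<^sup>2"
          using zero_le_power2[of "cmod ?u - cmod ?v"] by (simp add: power2_eq_square algebra_simps)
        finally have "?t z \<alpha> \<le> mi_coeff b \<alpha> * (2 * (cmod ?u)\<^sup>2 + 2 * (cmod ?v)\<^sup>2)"
          using mi_coeff_nonneg by (intro mult_left_mono)
        then show "?t z \<alpha> \<le> 2 * (mi_coeff b \<alpha> * (cmod ?u)\<^sup>2) + 2 * (mi_coeff b \<alpha> * (cmod ?v)\<^sup>2)"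
          by (simp add: algebra_simps)
      qed
      also have "\<dots> \<le> 2 * (e / 8) + 2 * (e / 8)"
        unfolding sum.distrib sum_distrib_left[symmetric]
        using elim(2) lam by (intro add_mono mult_left_mono tail) auto
      finally have "sum (?t z) (F - G) \<le> e / 2" by simp
      moreover have "sum (?t z) F = sum (?t z) (F \<inter> G) + sum (?t z) (F - G)"
        by (rule sum.Int_Diff[OF F])
      ultimately show "sum (?t z) F \<le> e"
        using low elim(1) by linarith
    qed
  qed
qed

lemma mi_coeff_unit: "mi_coeff b (mi_unit i) = b 1"
proof -
  have "(\<Prod>j\<in>UNIV. fact (if j = i then 1 else 0)) = (1 :: real)"
    by (rule prod.neutral) auto
  then show ?thesis
    by (simp add: mi_coeff_def mi_nth_unit)
qed

lemma vec_mpow_unit: "vec_mpow z (mi_unit i) = z $ i"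
  by (simp add: vec_mpow_def mi_nth_unit if_distrib prod.delta cong: if_cong)

end

section \<open>The row operators of a \<open>1/k\<close>-contraction\<close>

definition scaleC_op :: "complex \<Rightarrow> 'h \<Rightarrow>\<^sub>L 'h :: chilbert_space"
  where "scaleC_op c = Blinfun ((*\<^sub>C) c)"

lemma scaleC_op_apply [simp]: "scaleC_op c x = c *\<^sub>C x"
  by (simp add: scaleC_op_def bounded_linear_Blinfun_apply bounded_linear_scaleC)

lemma complex_linear_scaleC_op: "complex_linear (scaleC_op c)"
  by (simp add: complex_linear_def scaleC_scaleC mult.commute)

lemma adj_scaleC_op: "adj (scaleC_op c) = scaleC_op (cnj c)"
  by (rule adj_unique) (simp add: cinner_scaleC_left cinner_scaleC_right)

lemma op_inverse_eq:
  assumes "A o\<^sub>L B = id_blinfun" "B o\<^sub>L A = id_blinfun"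
  shows "op_inverse A = B"
  unfolding op_inverse_def
proof (rule the_equality)
  fix C assume C: "A o\<^sub>L C = id_blinfun \<and> C o\<^sub>L A = id_blinfun"
  show "C = B"
  proof (rule blinfun_eqI)
    fix x
    have "C (A (B x)) = B x"
      using C by (metis blinfun_apply_blinfun_compose blinfun_apply_id_blinfun id_apply)
    moreover have "A (B x) = x"
      using assms(1) by (metis blinfun_apply_blinfun_compose blinfun_apply_id_blinfun id_apply)
    ultimately show "C x = B x" by simp
  qed
qed (use assms in blast)

lemma complex_linear_op_pow: "complex_linear A \<Longrightarrow> complex_linear (op_pow A n)"
  by (induction n) (auto simp: op_pow_def intro: complex_linear_compose complex_linear_id)

lemma complex_linear_op_mpow:
  assumes "\<And>i. complex_linear (T i)"
  shows "complex_linear (op_mpow T \<alpha>)"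
proof -
  have "complex_linear (foldr (\<lambda>i A. op_pow (T i) (mi_nth \<alpha> i) o\<^sub>L A) xs id_blinfun)" for xs
    by (induction xs) (auto intro: complex_linear_compose complex_linear_id complex_linear_op_pow assms)
  then show ?thesis
    by (simp add: op_mpow_def)
qed

lemma op_mpow_unit: "op_mpow T (mi_unit i) = T i"
proof -
  let ?f = "\<lambda>j A. op_pow (T j) (mi_nth (mi_unit i) j) o\<^sub>L A"
  have "foldr ?f xs id_blinfun = (if i \<in> set xs then T i else id_blinfun)" if "distinct xs" for xs
    using that by (induction xs) (auto simp: mi_nth_unit op_pow_def intro!: blinfun_eqI)
  then show ?thesis
    by (simp add: op_mpow_def)
qed

text \<open>Exactness in the top degree \<open>S = UNIV\<close>, where every element is a cycle.\<close>

lemma taylor_nonsingular_imp_surjective: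
  fixes A :: "'d::{finite,linorder} \<Rightarrow> 'h::real_vector \<Rightarrow> 'h"
  assumes zero: "\<And>i. A i 0 = 0" and neg: "\<And>i x. A i (- x) = - A i x"
    and "taylor_nonsingular A"
  shows "\<exists>x. h = (\<Sum>i\<in>UNIV. A i (x i))"
proof -
  define X where "X S = (if S = UNIV then h else 0)" for S :: "'d set"
  have "koszul_map A X S = 0" for S
  proof -
    have "X (S - {i}) = 0" for i
      by (auto simp: X_def)
    then show ?thesis
      by (simp add: koszul_map_def zero)
  qed
  then have "koszul_map A X = (\<lambda>_. 0)"
    by (rule ext)
  then have "X \<in> range (koszul_map A)"
    using assms(3) unfolding taylor_nonsingular_def by blast
  then obtain Y where Y: "X = koszul_map A Y" by blast
  \<comment> \<open>Each \<open>A i\<close> is odd, so the Koszul sign can be absorbed into the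
    witness.\<close>
  have sign: "(-1) ^ n *\<^sub>R A i y = A i ((-1) ^ n *\<^sub>R y)" for n i y
    by (cases "even n") (simp_all add: neg)
  have "h = X UNIV"
    by (simp add: X_def)
  also have "\<dots> = (\<Sum>i\<in>UNIV. A i ((-1) ^ card {j. j < i} *\<^sub>R Y (UNIV - {i})))"
    by (simp add: Y koszul_map_def sign)
  finally show ?thesis
    by (rule exI[of _ "\<lambda>i. (-1) ^ card {j. j < i} *\<^sub>R Y (UNIV - {i})"])
qed

locale one_over_k_tuple = kernel_coefficients b
  for b :: "nat \<Rightarrow> real" +
  fixes T :: "'d::{finite,linorder} \<Rightarrow> 'h \<Rightarrow>\<^sub>L 'h::chilbert_space"
  assumes contraction: "one_over_k_contraction b T"
begin

abbreviation R where "R \<equiv> row_op b T"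
abbreviation Z where "Z \<equiv> scalar_row_op b :: complex ^ 'd::{finite,linorder} \<Rightarrow> ('d multiindex, 'h) hsum \<Rightarrow>\<^sub>L 'h"

definition row_entry :: "'d multiindex \<Rightarrow> 'h \<Rightarrow>\<^sub>L 'h"
  where "row_entry \<alpha> = sqrt (mi_coeff b \<alpha>) *\<^sub>R op_mpow T \<alpha>"

definition scalar_entry :: "complex ^ 'd::{finite,linorder} \<Rightarrow> 'd multiindex \<Rightarrow> 'h \<Rightarrow>\<^sub>L 'h"
  where "scalar_entry z \<alpha> = sqrt (mi_coeff b \<alpha>) *\<^sub>R scaleC_op (vec_mpow z \<alpha>)"

lemma complex_linear_T: "complex_linear (T i)"
  using contraction by (simp add: one_over_k_contraction_def commuting_tuple_def)

lemma complex_linear_mpow: "complex_linear (op_mpow T \<alpha>)"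
  by (rule complex_linear_op_mpow) (rule complex_linear_T)

lemma adj_row_entry: "adj (row_entry \<alpha>) = sqrt (mi_coeff b \<alpha>) *\<^sub>R adj (op_mpow T \<alpha>)"
  by (simp add: row_entry_def adj_scaleR complex_linear_mpow)

lemma row_entry_adj: "row_entry \<alpha> (adj (row_entry \<alpha>) y) = contraction_term b T \<alpha> y"
  unfolding adj_row_entry by (simp add: row_entry_def contraction_term_def blinfun.scaleR_left
      blinfun.scaleR_right mi_coeff_nonneg)

lemma adj_scalar_entry: "adj (scalar_entry z \<alpha>) y = sqrt (mi_coeff b \<alpha>) *\<^sub>R cnj (vec_mpow z \<alpha>) *\<^sub>C y"
  by (simp add: scalar_entry_def adj_scaleR complex_linear_scaleC_op adj_scaleC_op blinfun.scaleR_left)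

text \<open>Pairing the strongly convergent sum with \<open>y\<close> produces the sum of the
  squared adjoint norms, whose finite parts are at most \<open>inner (S y) y\<close>.\<close>

sublocale row: row_contraction row_entry
proof
  show cl: "complex_linear (row_entry \<alpha>)" for \<alpha>
    by (simp add: row_entry_def complex_linear_scaleR complex_linear_mpow)
  fix F :: "'d multiindex set" and y :: 'h
  assume F: "finite F"
  obtain S :: "'h \<Rightarrow>\<^sub>L 'h" where S: "norm S \<le> 1"
    "((\<lambda>\<alpha>. contraction_term b T \<alpha> y) has_sum S y) UNIV"
    using contraction unfolding one_over_k_contraction_def by blast
  have entry: "(norm (adj (row_entry \<alpha>) y))\<^sup>2 = inner (contraction_term b T \<alpha> y) y" for \<alpha>
    unfolding norm_adj_apply_sq[OF cl] row_entry_adj ..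
  have "((\<lambda>\<alpha>. (norm (adj (row_entry \<alpha>) y))\<^sup>2) has_sum inner (S y) y) UNIV"
    unfolding entry by (rule has_sum_bounded_linear[OF bounded_linear_inner_left S(2)])
  then have "(\<Sum>\<alpha>\<in>F. (norm (adj (row_entry \<alpha>) y))\<^sup>2) \<le> inner (S y) y"
    by (rule finite_sum_le_has_sum) (use F in auto)
  also have "\<dots> \<le> norm (S y) * norm y"
    by (rule norm_cauchy_schwarz)
  also have "\<dots> \<le> (norm y)\<^sup>2"
    unfolding power2_eq_square using S(1)
    by (intro mult_right_mono order_trans[OF norm_blinfun] mult_left_le_one_le) auto
  finally show "(\<Sum>\<alpha>\<in>F. (norm (adj (row_entry \<alpha>) y))\<^sup>2) \<le> (norm y)\<^sup>2" .
qed

lemma R_eq: "R = row_operator row_entry"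
  by (simp add: row_op_def row_operator_def row_entry_def blinfun.scaleR_left)

lemma Z_eq: "Z z = row_operator (scalar_entry z)"
  by (simp add: scalar_row_op_def row_operator_def scalar_entry_def blinfun.scaleR_left)

text \<open>The whole closed ball is covered, because the \<open>b n\<close> themselves add up to at
  most 1.\<close>

lemma row_contraction_scalar:
  assumes "norm z \<le> 1"
  shows "row_contraction (scalar_entry z)"
proof
  show "complex_linear (scalar_entry z \<alpha>)" for \<alpha>
    by (simp add: scalar_entry_def complex_linear_scaleR complex_linear_scaleC_op)
  fix F :: "'d multiindex set" and y :: 'h
  assume F: "finite F"
  have "(\<Sum>\<alpha>\<in>F. (norm (adj (scalar_entry z \<alpha>) y))\<^sup>2)
      = (\<Sum>\<alpha>\<in>F. mi_coeff b \<alpha> * (cmod (vec_mpow z \<alpha>))\<^sup>2) * (norm y)\<^sup>2"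
    by (simp add: adj_scalar_entry norm_scaleC power_mult_distrib mi_coeff_nonneg sum_distrib_right
        mult.assoc)
  also have "\<dots> \<le> 1 * (norm y)\<^sup>2"
  proof (rule mult_right_mono)
    have "0 \<notin> degree ` F"
      using degree_pos by (metis imageE not_one_le_zero)
    then show "(\<Sum>\<alpha>\<in>F. mi_coeff b \<alpha> * (cmod (vec_mpow z \<alpha>))\<^sup>2) \<le> 1"
      using sum_mi_coeff_le[OF assms F] sum_b_set_le[of "degree ` F"] F by force
  qed simp
  finally show "(\<Sum>\<alpha>\<in>F. (norm (adj (scalar_entry z \<alpha>) y))\<^sup>2) \<le> (norm y)\<^sup>2" by simp
qed

lemma complex_linear_R: "complex_linear R"
  by (simp add: R_eq row.complex_linear_row_operator)

lemma norm_R: "norm R \<le> 1"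
  by (simp add: R_eq row.norm_row_operator)

lemma complex_linear_Z: "norm z \<le> 1 \<Longrightarrow> complex_linear (Z z)"
  by (simp add: Z_eq row_contraction.complex_linear_row_operator row_contraction_scalar)

lemma norm_Z: "norm z \<le> 1 \<Longrightarrow> norm (Z z) \<le> 1"
  by (simp add: Z_eq row_contraction.norm_row_operator row_contraction_scalar)

lemma R_single: "R (hsum_single (mi_unit i) h) = sqrt (b 1) *\<^sub>R T i h"
  by (simp add: R_eq row.row_operator_single) (simp add: row_entry_def mi_coeff_unit op_mpow_unit blinfun.scaleR_left)

lemma Z_single: "norm z \<le> 1 \<Longrightarrow> Z z (hsum_single (mi_unit i) h) = sqrt (b 1) *\<^sub>R (z $ i) *\<^sub>C h"
  by (simp add: Z_eq row_contraction.row_operator_single row_contraction_scalar)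
    (simp add: scalar_entry_def mi_coeff_unit vec_mpow_unit blinfun.scaleR_left)

lemma hsum_nth_adj_R: "hsum_nth (adj R y) \<alpha> = sqrt (mi_coeff b \<alpha>) *\<^sub>R adj (op_mpow T \<alpha>) y"
  by (simp add: R_eq row.hsum_nth_adj_row_operator adj_row_entry blinfun.scaleR_left)

lemma hsum_nth_adj_Z: "norm z \<le> 1 \<Longrightarrow>
    hsum_nth (adj (Z z) y) \<alpha> = sqrt (mi_coeff b \<alpha>) *\<^sub>R cnj (vec_mpow z \<alpha>) *\<^sub>C y"
  by (simp add: Z_eq row_contraction.hsum_nth_adj_row_operator row_contraction_scalar adj_scalar_entry)

section \<open>The two defect operators\<close>

lemma norm_compose_le_1: "norm A \<le> 1 \<Longrightarrow> norm B \<le> 1 \<Longrightarrow> norm (A o\<^sub>L B) \<le> 1"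
  by (rule order_trans[OF norm_blinfun_compose]) (simp add: mult_le_one)

lemma norm_adj_R: "norm (adj R) \<le> 1"
  by (simp add: norm_adj complex_linear_R norm_R)

text \<open>The strong sum in \<open>defect_op\<close> is recognised as
  \<open>R o\<^sub>L adj R\<close>; after that both definite descriptions \<open>op_sqrt\<close>
  become limits of the explicit iteration.\<close>

lemma
  shows defect_op_eq: "defect_op b T = sqrt_one_minus (R o\<^sub>L adj R)"
    and row_defect_op_eq: "row_defect_op b T = sqrt_one_minus (adj R o\<^sub>L R)"
    and positive_defect_op: "positive_op (defect_op b T)"
    and positive_row_defect_op: "positive_op (row_defect_op b T)"
proof -
  note cl = complex_linear_R complex_linear_adj[OF complex_linear_R]
  have "Blinfun (\<lambda>h. \<Sum>\<^sub>\<infinity>\<alpha>. contraction_term b T \<alpha> h) = Blinfun (\<lambda>h. R (adj R h))"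
  proof (rule arg_cong[of _ _ Blinfun], rule ext)
    fix h
    have "((\<lambda>\<alpha>. contraction_term b T \<alpha> h) has_sum R (adj R h)) UNIV"
      using row.row_operator_has_sum[of "adj R h"]
      by (simp add: R_eq[symmetric] hsum_nth_adj_R row_entry_adj[symmetric] adj_row_entry
          blinfun.scaleR_left)
    then show "(\<Sum>\<^sub>\<infinity>\<alpha>. contraction_term b T \<alpha> h) = R (adj R h)"
      by (rule infsumI)
  qed
  also have "\<dots> = R o\<^sub>L adj R"
    by (rule blinfun_eqI, subst bounded_linear_Blinfun_apply) (auto intro!: bounded_linear_intros)
  finally have sum_eq: "Blinfun (\<lambda>h. \<Sum>\<^sub>\<infinity>\<alpha>. contraction_term b T \<alpha> h) = R o\<^sub>L adj R" .
  have sym: "inner ((R o\<^sub>L adj R) x) y = inner x ((R o\<^sub>L adj R) y)" for x y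
    by (simp add: inner_adj_left[OF complex_linear_R, symmetric]
        inner_adj_right[OF complex_linear_R, symmetric])
  have sym': "inner ((adj R o\<^sub>L R) x) y = inner x ((adj R o\<^sub>L R) y)" for x y
    by (simp add: inner_adj_left inner_adj_right complex_linear_R)
  have le: "norm (R o\<^sub>L adj R) \<le> 1" "norm (adj R o\<^sub>L R) \<le> 1"
    by (intro norm_compose_le_1 norm_R norm_adj_R)+
  have cl2: "complex_linear (R o\<^sub>L adj R)" "complex_linear (adj R o\<^sub>L R)"
    by (intro complex_linear_compose cl)+
  show 1: "defect_op b T = sqrt_one_minus (R o\<^sub>L adj R)"
    unfolding defect_op_def sum_eq by (rule op_sqrt_one_minus[OF le(1) cl2(1) sym])
  show 2: "row_defect_op b T = sqrt_one_minus (adj R o\<^sub>L R)"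
    unfolding row_defect_op_def by (rule op_sqrt_one_minus[OF le(2) cl2(2) sym'])
  show "positive_op (defect_op b T)"
    unfolding 1 by (rule positive_op_sqrt_one_minus[OF le(1) cl2(1) sym])
  show "positive_op (row_defect_op b T)"
    unfolding 2 by (rule positive_op_sqrt_one_minus[OF le(2) cl2(2) sym'])
qed

text \<open>\<open>R\<close> intertwines \<open>adj R o\<^sub>L R\<close> with
  \<open>R o\<^sub>L adj R\<close> by associativity, and intertwining passes to the square
  roots.\<close>

lemma R_row_defect: "R (row_defect_op b T x) = defect_op b T (R x)"
proof -
  have "R o\<^sub>L row_defect_op b T = defect_op b T o\<^sub>L R"
    unfolding defect_op_eq row_defect_op_eq
    by (rule sqrt_one_minus_intertwines)
      (auto intro!: norm_compose_le_1 norm_R norm_adj_R blinfun_eqI)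
  then show ?thesis
    by (metis blinfun_apply_blinfun_compose)
qed

lemma row_defect_square: "row_defect_op b T (row_defect_op b T x) = x - adj R (R x)"
proof -
  have "row_defect_op b T o\<^sub>L row_defect_op b T = id_blinfun - (adj R o\<^sub>L R)"
    unfolding row_defect_op_eq by (intro sqrt_one_minus_square norm_compose_le_1 norm_R norm_adj_R)
  then have "(row_defect_op b T o\<^sub>L row_defect_op b T) x = (id_blinfun - (adj R o\<^sub>L R)) x"
    by simp
  then show ?thesis
    by (simp add: blinfun.diff_left)
qed

text \<open>The norm is estimated on the adjoint, whose components are explicit scalar multiples of
  \<open>y\<close>.\<close>

lemma Z_tendsto:
  assumes lam: "norm lam \<le> 1"
  shows "((\<lambda>z. norm (Z z - Z lam)) \<longlongrightarrow> 0) (at lam within ball 0 1)"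
proof (rule tendstoI)
  fix e :: real assume e: "0 < e"
  have "\<forall>\<^sub>F z in at lam within ball 0 1. z \<in> ball 0 1"
    by (simp add: eventually_at_filter)
  moreover have "\<forall>\<^sub>F z in at lam within ball 0 1. \<forall>F. finite F \<longrightarrow>
    (\<Sum>\<alpha>\<in>F. mi_coeff b \<alpha> * (cmod (vec_mpow z \<alpha> - vec_mpow lam \<alpha>))\<^sup>2) \<le> (e / 2)\<^sup>2"
    using e by (intro mi_coeff_diff_tendsto lam) simp
  ultimately show "\<forall>\<^sub>F z in at lam within ball 0 1. dist (norm (Z z - Z lam)) 0 < e"
  proof eventually_elim
    case (elim z)
    then have z: "norm z \<le> 1" by simp
    have cl: "complex_linear (Z z - Z lam)"
      by (intro complex_linear_diff complex_linear_Z z lam)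
    have "norm (adj (Z z - Z lam)) \<le> e / 2"
    proof (rule norm_blinfun_bound)
      fix y
      show "norm (adj (Z z - Z lam) y) \<le> e / 2 * norm y"
      proof (rule norm_hsum_le)
        fix F :: "'d multiindex set" assume F: "finite F"
        have "hsum_nth (adj (Z z - Z lam) y) \<alpha>
            = sqrt (mi_coeff b \<alpha>) *\<^sub>R cnj (vec_mpow z \<alpha> - vec_mpow lam \<alpha>) *\<^sub>C y" for \<alpha>
          by (simp add: adj_diff complex_linear_Z z lam blinfun.diff_left minus_hsum.rep_eq
              hsum_nth_adj_Z complex_vector.scale_left_diff_distrib scaleR_diff_right)
        then have "(\<Sum>\<alpha>\<in>F. (norm (hsum_nth (adj (Z z - Z lam) y) \<alpha>))\<^sup>2)
            = (\<Sum>\<alpha>\<in>F. mi_coeff b \<alpha> * (cmod (vec_mpow z \<alpha> - vec_mpow lam \<alpha>))\<^sup>2) * (norm y)\<^sup>2"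
          by (simp add: norm_scaleC power_mult_distrib mi_coeff_nonneg sum_distrib_right mult.assoc
              complex_cnj_diff[symmetric] del: complex_cnj_diff)
        also have "\<dots> \<le> (e / 2)\<^sup>2 * (norm y)\<^sup>2"
          using elim(2) F by (intro mult_right_mono) auto
        finally show "(\<Sum>\<alpha>\<in>F. (norm (hsum_nth (adj (Z z - Z lam) y) \<alpha>))\<^sup>2) \<le> (e / 2 * norm y)\<^sup>2"
          by (simp only: power_mult_distrib)
      qed (use e in simp)
    qed (use e in simp)
    then show ?case
      using e by (simp add: norm_adj cl)
  qed
qed

lemma coercive:
  assumes bound: "\<And>y. c * (norm y)\<^sup>2 \<le> (\<Sum>i\<in>UNIV. (norm (adj (T i) y - cnj (lam $ i) *\<^sub>C y))\<^sup>2)"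
    and z: "norm z \<le> 1" "(norm (z - lam))\<^sup>2 \<le> c / 4"
  shows "b 1 * c / 8 * (norm x)\<^sup>2 \<le> inner ((id_blinfun - (Z z o\<^sub>L adj R)) x) x"
proof -
  define u where "u i = adj (T i) x - cnj (z $ i) *\<^sub>C x" for i
  have norm_diff: "(norm (z - lam))\<^sup>2 = (\<Sum>i\<in>UNIV. (cmod (z $ i - lam $ i))\<^sup>2)"
    by (simp add: norm_vec_def L2_set_def sum_nonneg)
  \<comment> \<open>Replacing \<open>lam\<close> by \<open>z\<close> doubles the main sum and adds
    an error of at most \<open>c / 2 * (norm x)\<^sup>2\<close>; this leaves \<open>c / 4\<close> as
    the constant for the \<open>u i\<close>.\<close>
  have "c * (norm x)\<^sup>2 \<le> (\<Sum>i\<in>UNIV. 2 * (norm (u i))\<^sup>2 + 2 * ((cmod (z $ i - lam $ i))\<^sup>2 * (norm x)\<^sup>2))"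
  proof (rule order_trans[OF bound], rule sum_mono)
    fix i
    have "adj (T i) x - cnj (lam $ i) *\<^sub>C x = u i + cnj (z $ i - lam $ i) *\<^sub>C x"
      by (simp add: u_def complex_vector.scale_left_diff_distrib)
    moreover have "norm (cnj (z $ i - lam $ i) *\<^sub>C x) = cmod (z $ i - lam $ i) * norm x"
      by (simp only: norm_scaleC complex_mod_cnj)
    ultimately have "norm (adj (T i) x - cnj (lam $ i) *\<^sub>C x)
        \<le> norm (u i) + cmod (z $ i - lam $ i) * norm x"
      using norm_triangle_ineq[of "u i" "cnj (z $ i - lam $ i) *\<^sub>C x"] by simp
    then have "(norm (adj (T i) x - cnj (lam $ i) *\<^sub>C x))\<^sup>2
        \<le> (norm (u i) + cmod (z $ i - lam $ i) * norm x)\<^sup>2"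
      by (rule power_mono) simp
    also have "\<dots> \<le> 2 * (norm (u i))\<^sup>2 + 2 * ((cmod (z $ i - lam $ i))\<^sup>2 * (norm x)\<^sup>2)"
      using zero_le_power2[of "norm (u i) - cmod (z $ i - lam $ i) * norm x"]
      by (simp add: power2_eq_square algebra_simps)
    finally show "(norm (adj (T i) x - cnj (lam $ i) *\<^sub>C x))\<^sup>2 \<le> \<dots>" .
  qed
  also have "\<dots> = 2 * (\<Sum>i\<in>UNIV. (norm (u i))\<^sup>2) + 2 * ((norm (z - lam))\<^sup>2 * (norm x)\<^sup>2)"
    by (simp add: sum.distrib sum_distrib_left sum_distrib_right norm_diff)
  also have "\<dots> \<le> 2 * (\<Sum>i\<in>UNIV. (norm (u i))\<^sup>2) + 2 * (c / 4 * (norm x)\<^sup>2)"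
    using z(2) by (intro add_left_mono mult_left_mono mult_right_mono) auto
  finally have u: "c / 4 * (norm x)\<^sup>2 \<le> (\<Sum>i\<in>UNIV. (norm (u i))\<^sup>2)"
    by simp
  define r where "r = adj R x"
  define s where "s = adj (Z z) x"
  have "norm r \<le> norm x" "norm s \<le> norm x"
    unfolding r_def s_def
    using norm_blinfun[of "adj R" x] norm_blinfun[of "adj (Z z)" x] norm_R norm_Z[OF z(1)]
    by (simp_all add: norm_adj complex_linear_R complex_linear_Z z)
      (meson mult_left_le_one_le norm_ge_zero order_trans)+
  then have rs: "(norm r)\<^sup>2 \<le> (norm x)\<^sup>2" "(norm s)\<^sup>2 \<le> (norm x)\<^sup>2"
    by (auto intro: power_mono)
  have "b 1 * (\<Sum>i\<in>UNIV. (norm (u i))\<^sup>2) = (\<Sum>\<alpha>\<in>range mi_unit. (norm (hsum_nth (r - s) \<alpha>))\<^sup>2)"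
  proof -
    have "hsum_nth (r - s) (mi_unit i) = sqrt (b 1) *\<^sub>R u i" for i
      by (simp add: r_def s_def minus_hsum.rep_eq hsum_nth_adj_R hsum_nth_adj_Z z mi_coeff_unit
          op_mpow_unit vec_mpow_unit u_def scaleR_diff_right)
    then show ?thesis
      using b_1_pos by (simp add: sum.reindex inj_mi_unit power_mult_distrib sum_distrib_left)
  qed
  also have "\<dots> \<le> (norm (r - s))\<^sup>2"
    by (rule sum_le_norm_hsum_sq) simp
  also have "\<dots> = (norm r)\<^sup>2 + (norm s)\<^sup>2 - 2 * inner r s"
    by (simp add: power2_norm_eq_inner inner_diff_left inner_diff_right inner_commute)
  \<comment> \<open>\<open>r\<close> and \<open>s\<close> are no longer than \<open>x\<close>, and
    \<open>inner r s\<close> is precisely the term subtracted in the pencil.\<close>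
  also have "\<dots> \<le> 2 * inner ((id_blinfun - (Z z o\<^sub>L adj R)) x) x"
  proof -
    have "inner r s = inner (Z z (adj R x)) x"
      by (simp add: r_def s_def inner_adj_right complex_linear_Z z)
    then show ?thesis
      using rs by (simp add: blinfun.diff_left inner_diff_left power2_norm_eq_inner)
  qed
  finally have "b 1 * (\<Sum>i\<in>UNIV. (norm (u i))\<^sup>2) \<le> 2 * inner ((id_blinfun - (Z z o\<^sub>L adj R)) x) x" .
  moreover have "b 1 * (c / 4 * (norm x)\<^sup>2) \<le> b 1 * (\<Sum>i\<in>UNIV. (norm (u i))\<^sup>2)"
    using u b_1_pos by (intro mult_left_mono) auto
  ultimately show ?thesis by simp
qed

end

section \<open>Limits of the characteristic function\<close>

lemma norm_blinfun_apply_le: "norm x \<le> 1 \<Longrightarrow> norm (blinfun_apply A x) \<le> norm A"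
  by (rule order_trans[OF norm_blinfun]) (simp add: mult_left_le)

lemma opnorm_on_bdd_above: "bdd_above {norm (blinfun_apply A x) | x. x \<in> D \<and> norm x \<le> 1}"
  by (rule bdd_aboveI[of _ "norm A"]) (auto intro: norm_blinfun_apply_le)

lemma norm_le_opnorm_on: "x \<in> D \<Longrightarrow> norm x \<le> 1 \<Longrightarrow> norm (blinfun_apply A x) \<le> opnorm_on D A"
  unfolding opnorm_on_def by (rule cSup_upper[OF _ opnorm_on_bdd_above]) blast

lemma opnorm_on_nonneg: "0 \<in> D \<Longrightarrow> 0 \<le> opnorm_on D A"
  using norm_le_opnorm_on[of 0 D A] by simp

text \<open>\<open>0 \<in> D\<close> makes the set nonempty, so that its real supremum is a least
  upper bound.\<close>

lemma opnorm_on_le: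
  assumes "0 \<in> D"
  shows "opnorm_on D A \<le> norm A"
  unfolding opnorm_on_def
proof (rule cSup_least)
  show "{norm (A x) | x. x \<in> D \<and> norm x \<le> 1} \<noteq> {}"
    using assms by (auto intro: exI[of _ 0])
qed (auto intro: norm_blinfun_apply_le)

text \<open>\<open>E_set\<close> speaks of an arbitrary limit \<open>L\<close>, which must be
  compared with the computed one. The line through \<open>x\<close> in \<open>D\<close> allows
  \<open>x\<close> to be scaled into the unit ball tested by \<open>opnorm_on\<close>.\<close>

lemma op_limit_unique:
  fixes \<theta> :: "complex ^ 'd \<Rightarrow> 'a::chilbert_space \<Rightarrow>\<^sub>L 'b::chilbert_space"
  assumes L: "op_limit D R \<theta> lam L" and L': "op_limit D R \<theta> lam L'"
    and lam: "lam \<in> cball 0 1" and x: "range (\<lambda>t. t *\<^sub>R x) \<subseteq> D"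
  shows "L x = L' x"
proof -
  define t where "t = 1 / (norm x + 1)"
  have "0 < norm x + 1"
    by (simp add: add_nonneg_pos)
  then have t: "0 < t" "norm (t *\<^sub>R x) \<le> 1"
    by (simp_all add: t_def)
  have tx: "t *\<^sub>R x \<in> D"
    using x by blast
  have "((\<lambda>z. opnorm_on D (\<theta> z - L) + opnorm_on D (\<theta> z - L')) \<longlongrightarrow> 0 + 0) (at lam within ball 0 1)"
    using L L' by (intro tendsto_add) (auto simp: op_limit_def)
  moreover have "norm (L (t *\<^sub>R x) - L' (t *\<^sub>R x)) \<le> opnorm_on D (\<theta> z - L) + opnorm_on D (\<theta> z - L')"
    for z
  proof -
    have "L (t *\<^sub>R x) - L' (t *\<^sub>R x) = (\<theta> z - L') (t *\<^sub>R x) - (\<theta> z - L) (t *\<^sub>R x)"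
      by (simp add: blinfun.diff_left)
    then show ?thesis
      using norm_triangle_ineq4[of "(\<theta> z - L') (t *\<^sub>R x)" "(\<theta> z - L) (t *\<^sub>R x)"]
        norm_le_opnorm_on[OF tx t(2), of "\<theta> z - L"] norm_le_opnorm_on[OF tx t(2), of "\<theta> z - L'"]
      by simp
  qed
  \<comment> \<open>Every point of the closed ball, on the boundary or inside, is a limit point of
    the open ball.\<close>
  moreover have "at lam within ball 0 1 \<noteq> bot"
    using lam by (simp add: trivial_limit_within islimpt_ball)
  ultimately have "norm (L (t *\<^sub>R x) - L' (t *\<^sub>R x)) \<le> 0 + 0"
    by (intro tendsto_lowerbound) auto
  then show ?thesis
    using t by (simp add: blinfun.scaleR_right)
qed

section \<open>The characteristic function near a point outside the Taylor spectrum\<close>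

context one_over_k_tuple
begin

abbreviation pencil where "pencil z \<equiv> id_blinfun - (Z z o\<^sub>L adj R)"
abbreviation resolvent where "resolvent z \<equiv> op_inverse (pencil z)"

lemma char_fun_apply:
  "char_fun b T z x = - R x + defect_op b T (resolvent z (Z z (row_defect_op b T x)))"
  by (simp add: char_fun_def blinfun.add_left blinfun.minus_left blinfun.diff_left)

context
  fixes lam :: "complex ^ 'd::{finite,linorder}"
  assumes lam: "norm lam \<le> 1" and regular: "lam \<notin> taylor_spectrum T"
begin

lemma shifted_row_surjective: "\<exists>x. h = (\<Sum>i\<in>UNIV. T i (x i) - (lam $ i) *\<^sub>C x i)"
proof (rule taylor_nonsingular_imp_surjective)
  show "taylor_nonsingular (\<lambda>i h. T i h - (lam $ i) *\<^sub>C h)"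
    using regular by (simp add: taylor_spectrum_def)
qed (simp_all add: blinfun.minus_right)

text \<open>Surjectivity of the shifted row supplies \<open>c\<close>; \<open>coercive\<close> and
  Lax-Milgram then invert the pencil with bound \<open>8 / (b 1 * c)\<close> for all
  \<open>z\<close> in the closed ball within \<open>sqrt (c / 4)\<close> of
  \<open>lam\<close>.\<close>

lemma resolvent_near:
  "\<exists>K r. 0 < r \<and> (\<forall>z. norm z \<le> 1 \<longrightarrow> norm (z - lam) \<le> r \<longrightarrow>
    pencil z o\<^sub>L resolvent z = id_blinfun \<and> resolvent z o\<^sub>L pencil z = id_blinfun \<and>
    norm (resolvent z) \<le> K)"
proof -
  have cl: "complex_linear (T i - scaleC_op (lam $ i))" for i
    by (intro complex_linear_diff complex_linear_T complex_linear_scaleC_op)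
  have adj: "adj (T i - scaleC_op (lam $ i)) y = adj (T i) y - cnj (lam $ i) *\<^sub>C y" for i y
    by (simp add: adj_diff complex_linear_T complex_linear_scaleC_op adj_scaleC_op blinfun.diff_left)
  have "\<exists>c>0. \<forall>y. c * (norm y)\<^sup>2 \<le> (\<Sum>i\<in>UNIV. (norm (adj (T i - scaleC_op (lam $ i)) y))\<^sup>2)"
  proof (rule surjective_row_adj_bounded_below)
    show "\<exists>x. h = (\<Sum>i\<in>UNIV. (T i - scaleC_op (lam $ i)) (x i))" for h
      using shifted_row_surjective[of h] by (simp add: blinfun.diff_left)
  qed (rule cl)
  then obtain c where c: "0 < c"
    "\<And>y. c * (norm y)\<^sup>2 \<le> (\<Sum>i\<in>UNIV. (norm (adj (T i) y - cnj (lam $ i) *\<^sub>C y))\<^sup>2)"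
    unfolding adj by blast
  have \<delta>: "0 < b 1 * c / 8"
    using c b_1_pos by simp
  have "pencil z o\<^sub>L resolvent z = id_blinfun \<and> resolvent z o\<^sub>L pencil z = id_blinfun \<and>
      norm (resolvent z) \<le> 1 / (b 1 * c / 8)"
    if z: "norm z \<le> 1" "norm (z - lam) \<le> sqrt (c / 4)" for z
  proof -
    have "(norm (z - lam))\<^sup>2 \<le> (sqrt (c / 4))\<^sup>2"
      by (rule power_mono[OF z(2)]) simp
    then have "(norm (z - lam))\<^sup>2 \<le> c / 4"
      using c by simp
    then obtain B where B: "pencil z o\<^sub>L B = id_blinfun" "B o\<^sub>L pencil z = id_blinfun"
      "norm B \<le> 1 / (b 1 * c / 8)"
      using lax_milgram[OF \<delta> coercive[OF c(2) z(1)]] by blast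
    moreover have "resolvent z = B"
      by (rule op_inverse_eq[OF B(1,2)])
    ultimately show ?thesis by simp
  qed
  moreover have "0 < sqrt (c / 4)"
    using c by simp
  ultimately show ?thesis by blast
qed

lemma
  shows pencil_resolvent: "pencil lam (resolvent lam x) = x"
    and resolvent_pencil: "resolvent lam (pencil lam x) = x"
proof -
  have "pencil lam o\<^sub>L resolvent lam = id_blinfun" "resolvent lam o\<^sub>L pencil lam = id_blinfun"
    using resolvent_near lam by (metis diff_self less_imp_le norm_zero)+
  then show "pencil lam (resolvent lam x) = x" "resolvent lam (pencil lam x) = x"
    by (metis blinfun_apply_blinfun_compose blinfun_apply_id_blinfun id_apply)+
qed

lemma complex_linear_char_fun: "complex_linear (char_fun b T lam)"
proof -
  have A: "complex_linear (pencil lam)"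
    by (intro complex_linear_diff complex_linear_id complex_linear_compose complex_linear_Z lam
        complex_linear_adj complex_linear_R)
  have "resolvent lam (c *\<^sub>C x) = c *\<^sub>C resolvent lam x" for c x
    using resolvent_pencil[of "c *\<^sub>C resolvent lam x"]
    unfolding complex_linearD[OF A] pencil_resolvent .
  then have "complex_linear (resolvent lam)"
    by (simp add: complex_linear_def)
  then show ?thesis
    unfolding char_fun_def
    by (intro complex_linear_add complex_linear_minus complex_linear_compose complex_linear_R
        complex_linear_Z lam positive_op_complex_linear[OF positive_defect_op]
        positive_op_complex_linear[OF positive_row_defect_op])
qed

text \<open>On the range of the row defect operator its square appears, which is
  \<open>I - adj R R\<close>. The term \<open>Z lam (adj R (R x))\<close> cancels against the pencil
  at \<open>- R x\<close>, and \<open>R_row_defect\<close> pulls the defect operator out in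
  front.\<close>

lemma char_fun_row_defect:
  "char_fun b T lam (row_defect_op b T x) = defect_op b T (resolvent lam (Z lam x - R x))"
proof -
  have "Z lam x - R x = pencil lam (- R x) + Z lam (row_defect_op b T (row_defect_op b T x))"
    by (simp add: row_defect_square blinfun.diff_left blinfun.diff_right blinfun.minus_right)
  then have "resolvent lam (Z lam x - R x)
      = - R x + resolvent lam (Z lam (row_defect_op b T (row_defect_op b T x)))"
    by (simp only: blinfun.add_right resolvent_pencil)
  then show ?thesis
    by (simp add: char_fun_apply R_row_defect blinfun.add_right blinfun.diff_right blinfun.minus_right)
qed

text \<open>The factorisation settles the dense range of the row defect operator; continuity extends
  the inclusion to its closure.\<close>

lemma char_fun_maps_into: "char_fun b T lam ` row_defect_space b T \<subseteq> defect_space b T"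
  unfolding row_defect_space_def
proof (rule image_closure_subset)
  show "continuous_on (closure (op_range (row_defect_op b T))) (char_fun b T lam)"
    by (rule linear_continuous_on) (rule blinfun.bounded_linear_right)
  show "char_fun b T lam ` op_range (row_defect_op b T) \<subseteq> defect_space b T"
    unfolding defect_space_def op_range_def
    by (rule subset_trans[OF _ closure_subset]) (auto simp: char_fun_row_defect)
qed (simp add: defect_space_def)

lemma defect_range_subset: "op_range (defect_op b T) \<subseteq> char_fun b T lam ` op_range (row_defect_op b T)"
proof
  fix y assume "y \<in> op_range (defect_op b T)"
  then obtain h where h: "y = defect_op b T h"
    by (auto simp: op_range_def)
  obtain x where x: "pencil lam h = (\<Sum>i\<in>UNIV. T i (x i) - (lam $ i) *\<^sub>C x i)"
    using shifted_row_surjective by blast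
  \<comment> \<open>\<open>u\<close> lives in degree one, where \<open>Z lam - R\<close> acts as
    \<open>sqrt (b 1)\<close> times \<open>lam $ i\<close> minus \<open>T i\<close>; the coefficient
    undoes this factor and its sign.\<close>
  define u where "u = (\<Sum>i\<in>UNIV. hsum_single (mi_unit i) ((- 1 / sqrt (b 1)) *\<^sub>R x i))"
  have "Z lam u - R u = (\<Sum>i\<in>UNIV. T i (x i) - (lam $ i) *\<^sub>C x i)"
    using b_1_pos by (simp add: u_def blinfun.sum_right Z_single lam R_single blinfun.scaleR_right
        blinfun.minus_right scaleC_scaleR sum_subtractf sum_negf)
  then have "y = char_fun b T lam (row_defect_op b T u)"
    by (simp only: char_fun_row_defect x[symmetric] resolvent_pencil h)
  then show "y \<in> char_fun b T lam ` op_range (row_defect_op b T)"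
    by (auto simp: op_range_def)
qed

lemma zero_in_row_defect_space: "0 \<in> row_defect_space b T"
proof -
  have "row_defect_op b T 0 \<in> op_range (row_defect_op b T)"
    by (simp only: op_range_def rangeI)
  then show ?thesis
    unfolding row_defect_space_def using closure_subset by (auto simp: blinfun.zero_right)
qed

lemma op_limit_char_fun:
  "op_limit (row_defect_space b T) (defect_space b T) (char_fun b T) lam (char_fun b T lam)"
  unfolding op_limit_def
proof (intro conjI complex_linear_char_fun char_fun_maps_into)
  obtain K r where r: "0 < r" and near: "\<And>z. norm z \<le> 1 \<Longrightarrow> norm (z - lam) \<le> r \<Longrightarrow>
      pencil z o\<^sub>L resolvent z = id_blinfun \<and> resolvent z o\<^sub>L pencil z = id_blinfun \<and>
      norm (resolvent z) \<le> K"
    using resolvent_near by blast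
  have Klam: "norm (resolvent lam) \<le> K"
    using near[OF lam] r by simp
  then have K: "0 \<le> K"
    using norm_ge_zero order_trans by blast
  \<comment> \<open>\<open>K + K * K\<close> is \<open>K * (1 + K)\<close>: one \<open>K\<close>
    bounds \<open>resolvent z\<close>, and \<open>1 + K\<close> comes from the two terms of
    \<open>g\<close> below.\<close>
  let ?C = "norm (defect_op b T) * (K + K * K) * norm (row_defect_op b T)"
  have bound: "norm (char_fun b T z - char_fun b T lam) \<le> ?C * norm (Z z - Z lam)"
    if z: "norm z \<le> 1" "norm (z - lam) \<le> r" for z
  proof (rule norm_blinfun_bound)
    fix x
    define v where "v = row_defect_op b T x"
    define w where "w = resolvent lam (Z lam v)"
    \<comment> \<open>Resolvent identity: \<open>g\<close> is what \<open>pencil z w\<close> lacks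
      to equal \<open>Z z v\<close>, and it is linear in \<open>Z z - Z lam\<close>.\<close>
    define g where "g = (Z z - Z lam) v + (Z z - Z lam) (adj R w)"
    have "resolvent z o\<^sub>L pencil z = id_blinfun"
      using near[OF z] by blast
    then have inv: "resolvent z (pencil z y) = y" for y
      by (metis blinfun_apply_blinfun_compose blinfun_apply_id_blinfun id_apply)
    have "Z z v = pencil z w + g"
    proof -
      have "Z lam v = pencil lam w"
        by (simp only: w_def pencil_resolvent)
      then show ?thesis
        by (simp add: g_def blinfun.diff_left)
    qed
    then have "resolvent z (Z z v) - w = resolvent z g"
      by (simp only: blinfun.add_right inv add_diff_cancel_left')
    then have eq: "(char_fun b T z - char_fun b T lam) x = defect_op b T (resolvent z g)"
      by (simp add: blinfun.diff_left char_fun_apply v_def[symmetric] w_def[symmetric]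
          blinfun.diff_right[symmetric])
    have v: "norm v \<le> norm (row_defect_op b T) * norm x"
      unfolding v_def by (rule norm_blinfun)
    have "norm w \<le> K * norm v"
    proof -
      have "norm (Z lam v) \<le> norm v"
        by (intro order_trans[OF norm_blinfun] mult_left_le_one_le norm_Z lam) auto
      then have "norm (resolvent lam) * norm (Z lam v) \<le> K * norm v"
        using K Klam by (intro mult_mono) auto
      then show ?thesis
        unfolding w_def by (rule order_trans[OF norm_blinfun])
    qed
    moreover have "norm (adj R w) \<le> norm w"
      by (intro order_trans[OF norm_blinfun] mult_left_le_one_le norm_adj_R) auto
    ultimately have "norm (adj R w) \<le> K * norm v"
      by linarith
    then have "norm ((Z z - Z lam) (adj R w)) \<le> norm (Z z - Z lam) * (K * norm v)"
      by (intro order_trans[OF norm_blinfun[of _ "adj R w"]] mult_left_mono) auto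
    then have "norm g \<le> norm (Z z - Z lam) * norm v + norm (Z z - Z lam) * (K * norm v)"
      unfolding g_def
      by (intro order_trans[OF norm_triangle_ineq] add_mono norm_blinfun)
    also have "\<dots> = (1 + K) * norm (Z z - Z lam) * norm v"
      by (simp add: algebra_simps)
    also have "\<dots> \<le> (1 + K) * norm (Z z - Z lam) * (norm (row_defect_op b T) * norm x)"
      using K v by (intro mult_left_mono) auto
    finally have g: "norm g \<le> (1 + K) * norm (Z z - Z lam) * (norm (row_defect_op b T) * norm x)" .
    have "norm (resolvent z g) \<le> K * norm g"
      using near[OF z] by (intro order_trans[OF norm_blinfun] mult_right_mono) auto
    also have "\<dots> \<le> K * ((1 + K) * norm (Z z - Z lam) * (norm (row_defect_op b T) * norm x))"
      using g K by (intro mult_left_mono)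
    finally have "norm (defect_op b T (resolvent z g)) \<le> norm (defect_op b T) *
        (K * ((1 + K) * norm (Z z - Z lam) * (norm (row_defect_op b T) * norm x)))"
      by (intro order_trans[OF norm_blinfun[of _ "resolvent z g"]] mult_left_mono) auto
    then show "norm ((char_fun b T z - char_fun b T lam) x) \<le> ?C * norm (Z z - Z lam) * norm x"
      unfolding eq by (simp add: algebra_simps)
  qed (use K in simp)
  have "((\<lambda>z. ?C * norm (Z z - Z lam)) \<longlongrightarrow> ?C * 0) (at lam within ball 0 1)"
    by (intro tendsto_intros Z_tendsto lam)
  then have lim: "((\<lambda>z. ?C * norm (Z z - Z lam)) \<longlongrightarrow> 0) (at lam within ball 0 1)"
    by simp
  have "\<forall>\<^sub>F z in at lam within ball 0 1. norm z \<le> 1 \<and> norm (z - lam) \<le> r"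
    using r by (auto simp: eventually_at dist_norm intro!: exI[of _ r])
  then have "\<forall>\<^sub>F z in at lam within ball 0 1.
      norm (opnorm_on (row_defect_space b T) (char_fun b T z - char_fun b T lam))
        \<le> ?C * norm (Z z - Z lam)"
  proof eventually_elim
    case (elim z)
    have "opnorm_on (row_defect_space b T) (char_fun b T z - char_fun b T lam)
        \<le> norm (char_fun b T z - char_fun b T lam)"
      by (rule opnorm_on_le[OF zero_in_row_defect_space])
    also have "\<dots> \<le> ?C * norm (Z z - Z lam)"
      using elim by (intro bound) auto
    finally show ?case
      by (simp only: real_norm_def abs_of_nonneg[OF opnorm_on_nonneg[OF zero_in_row_defect_space]])
  qed
  then show "((\<lambda>z. opnorm_on (row_defect_space b T) (char_fun b T z - char_fun b T lam)) \<longlongrightarrow> 0)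
      (at lam within ball 0 1)"
    by (rule Lim_null_comparison[OF _ lim])
qed

text \<open>By uniqueness \<open>L\<close> agrees with the computed limit on the range of the row
  defect operator. There it already attains the range of \<open>defect_op b T\<close>, which by
  closedness is all of \<open>defect_space b T\<close>.\<close>

lemma limit_surjective:
  assumes closed: "closed (op_range (defect_op b T))"
    and L: "op_limit (row_defect_space b T) (defect_space b T) (char_fun b T) lam L"
  shows "L ` row_defect_space b T = defect_space b T"
proof
  show "L ` row_defect_space b T \<subseteq> defect_space b T"
    using L by (simp add: op_limit_def)
  have "L (row_defect_op b T x) = char_fun b T lam (row_defect_op b T x)" for x
  proof (rule op_limit_unique[OF L op_limit_char_fun])
    show "range (\<lambda>t. t *\<^sub>R row_defect_op b T x) \<subseteq> row_defect_space b T"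
      unfolding row_defect_space_def op_range_def
      by (rule subset_trans[OF _ closure_subset]) (auto simp: blinfun.scaleR_right[symmetric])
  qed (use lam in simp)
  then have "char_fun b T lam ` op_range (row_defect_op b T) = L ` op_range (row_defect_op b T)"
    by (simp add: op_range_def image_image)
  moreover have "op_range (row_defect_op b T) \<subseteq> row_defect_space b T"
    unfolding row_defect_space_def by (rule closure_subset)
  ultimately show "defect_space b T \<subseteq> L ` row_defect_space b T"
    using defect_range_subset closed unfolding defect_space_def by (simp add: closure_closed) blast
qed

end

end

theorem theorem4p1:
  fixes k :: "complex ^ 'd::{finite,linorder} \<Rightarrow> complex ^ 'd::{finite,linorder} \<Rightarrow> complex"
    and a b :: "nat \<Rightarrow> real"
    and T :: "'d \<Rightarrow> 'h::chilbert_space \<Rightarrow>\<^sub>L 'h"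
  assumes "unitarily_invariant_CNP_kernel k a b"
    and "one_over_k_contraction b T"
    and "complex_finite_dim (op_range (defect_op b T))"
  shows "E_set (row_defect_space b T) (defect_space b T) (char_fun b T)
      \<union> F_set (row_defect_space b T) (defect_space b T) (char_fun b T)
    \<subseteq> taylor_spectrum T"
proof -
  interpret one_over_k_tuple b T
    by unfold_locales (use assms CNP_b_nonneg CNP_sum_b_le CNP_b_1_pos in auto)
  have closed: "closed (op_range (defect_op b T))"
    by (intro closed_op_range_finite_dim assms(3) positive_op_complex_linear positive_defect_op)
  show ?thesis
  proof (rule subsetI, rule ccontr)
    fix lam
    assume EF: "lam \<in> E_set (row_defect_space b T) (defect_space b T) (char_fun b T)
      \<union> F_set (row_defect_space b T) (defect_space b T) (char_fun b T)"
      and regular: "lam \<notin> taylor_spectrum T"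
    then have lam: "norm lam \<le> 1"
      by (auto simp: E_set_def F_set_def)
    show False
      using EF op_limit_char_fun[OF lam regular] limit_surjective[OF lam regular closed]
      by (auto simp: E_set_def F_set_def)
  qed
qed

end
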